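(* Let $G$ be a finite Frobenius group with Frobenius kernel $N$ and Frobenius complement $H$. Then $$(1-t)B_G(t)=1+\frac{1}{|H|}\Big((1-t)B_N(t)-1\Big)+\Big((1-t)B_H(t)-1\Big).$$
   Context: A finite group $G$ is a Frobenius group if it has a proper non-trivial subgroup $H$ (a Frobenius complement) such that $H\cap gHg^{-1}=\{1\}$ for all $g\in G\setminus H$; the Frobenius kernel is $N=\left(G\setminus\bigcup_{g\in G}gHg^{-1}\right)\cup\{1\}$, a normal subgroup with $G=N\rtimes H$. For a finite group $G$ and $n\ge0$, let $G^{(n)}\subseteq G^n$ be the set of $n$-tuples of pairwise commuting elements, on which $G$ acts by simultaneous conjugation; let $\beta_{G,n}$ be the number of orbits and $B_G(t)=\sum_{n\ge0}\beta_{G,n}t^n$. *)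

theory Defs
  imports "HOL-Algebra.Group" "HOL-Computational_Algebra.Formal_Power_Series"
begin

definition conj_set :: "('a, 'b) monoid_scheme \<Rightarrow> 'a \<Rightarrow> 'a set \<Rightarrow> 'a set" where
  "conj_set G g H = (\<lambda>h. g \<otimes>\<^bsub>G\<^esub> h \<otimes>\<^bsub>G\<^esub> inv\<^bsub>G\<^esub> g) ` H"

definition frobenius_complement :: "('a, 'b) monoid_scheme \<Rightarrow> 'a set \<Rightarrow> bool" where
  "frobenius_complement G H \<longleftrightarrow> subgroup H G \<and> H \<noteq> {\<one>\<^bsub>G\<^esub>} \<and> H \<noteq> carrier G \<and>
     (\<forall>g \<in> carrier G - H. H \<inter> conj_set G g H = {\<one>\<^bsub>G\<^esub>})"

definition frobenius_kernel :: "('a, 'b) monoid_scheme \<Rightarrow> 'a set \<Rightarrow> 'a set" where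
  "frobenius_kernel G H = (carrier G - (\<Union>g \<in> carrier G. conj_set G g H)) \<union> {\<one>\<^bsub>G\<^esub>}"

definition commuting_tuples :: "('a, 'b) monoid_scheme \<Rightarrow> nat \<Rightarrow> 'a list set" where
  "commuting_tuples G n = {xs. length xs = n \<and> set xs \<subseteq> carrier G \<and>
     (\<forall>i<n. \<forall>j<n. xs ! i \<otimes>\<^bsub>G\<^esub> xs ! j = xs ! j \<otimes>\<^bsub>G\<^esub> xs ! i)}"

definition sim_conj_rel :: "('a, 'b) monoid_scheme \<Rightarrow> nat \<Rightarrow> ('a list \<times> 'a list) set" where
  "sim_conj_rel G n = {(xs, ys). xs \<in> commuting_tuples G n \<and> ys \<in> commuting_tuples G n \<and>
     (\<exists>g \<in> carrier G. ys = map (\<lambda>x. g \<otimes>\<^bsub>G\<^esub> x \<otimes>\<^bsub>G\<^esub> inv\<^bsub>G\<^esub> g) xs)}"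

definition beta :: "('a, 'b) monoid_scheme \<Rightarrow> nat \<Rightarrow> nat" where
  "beta G n = card (commuting_tuples G n // sim_conj_rel G n)"

definition B_series :: "('a, 'b) monoid_scheme \<Rightarrow> rat fps" where
  "B_series G = Abs_fps (\<lambda>n. of_nat (beta G n))"

end

theory Submission
  imports Defs "HOL-Algebra.Group_Action" "HOL-Library.Function_Algebras"
    "HOL-Computational_Algebra.Fundamental_Theorem_Algebra"
begin

text \<open>
  If \<open>\<one> \<noteq> h \<in> H\<close>, then everything commuting with \<open>h\<close> lies in \<open>H\<close>. Hence a tuple of commuting
  elements either lies in \<open>N\<close>, or is a non-trivial tuple in exactly one of the \<open>|G : H|\<close> conjugates
  of \<open>H\<close>. By Burnside's lemma \<open>\<beta> G n * |G|\<close> is the number of commuting \<open>(n + 1)\<close>-tuples of \<open>G\<close>, and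
  likewise for \<open>H\<close> and \<open>N\<close>, which gives \<open>|H| * \<beta> G n + 1 = \<beta> N n + |H| * \<beta> H n\<close>.

  Burnside's lemma for \<open>N\<close> needs Frobenius's theorem that \<open>N\<close> is a subgroup. Its proof extends each
  irreducible character of \<open>H\<close> to one of \<open>G\<close> whose kernel contains \<open>N\<close>; the intersection of these
  kernels is \<open>N\<close>. Characters are obtained without representations, by averaging primitive
  self-adjoint idempotents of the group algebra over conjugation.
\<close>

section \<open>The group algebra\<close>

text \<open>The hard point is closure of \<open>N\<close> under products; everything up to
  \<open>subgroup_N\<close> serves it. Self-adjointness does the work of representation theory:
  \<open>(x \<star> star x) \<one>\<close> is the squared norm of \<open>x\<close>, and this
  positive trace detects zero, bounds how often a projection can be split, and makes
  \<open>f g = f \<one>\<close> equivalent to \<open>g\<close> fixing \<open>f\<close>. Primitivity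
  is taken in the form p A p = C p, in which Schur's lemma is used. As the algebra of
  \<open>H\<close> is literally contained in that of \<open>G\<close>, a projection for
  \<open>H\<close> is one for \<open>G\<close>, and \<open>cl (carrier G) e\<close> is the class
  function induced from \<open>cl H e\<close>; integrality of its inner products is then just
  decomposition into primitive projections. The extended function has norm one and integral
  coefficients, hence is a non-zero multiple of one irreducible character, and kernels of those are
  closed under products. In the count, the trivial tuple lies in \<open>N\<close> and has to be
  removed from every conjugate of \<open>H\<close>. There are |G : H| = |N| conjugates, so dividing
  by |N| leaves exactly the \<open>1\<close> of the identity, while |G| / |N| = |H| gives the
  factors |H|.\<close>

definition scl :: "complex \<Rightarrow> ('a \<Rightarrow> complex) \<Rightarrow> 'a \<Rightarrow> complex" where
  "scl c x = (\<lambda>g. c * x g)"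

text \<open>The group algebra of a subgroup \<open>K\<close> is encoded as the functions that vanish
  off \<open>K\<close>, so that algebras of subgroups are honest subalgebras and no embedding maps
  are needed.\<close>

definition supported :: "'a set \<Rightarrow> ('a \<Rightarrow> complex) \<Rightarrow> bool" where
  "supported K x \<longleftrightarrow> (\<forall>g. g \<notin> K \<longrightarrow> x g = 0)"

lemma degree_diff_eq_left: "degree q < degree p \<Longrightarrow> degree (p - q :: 'a :: ab_group_add poly) = degree p"
  using degree_add_eq_left[of "-q" p] by simp

lemma scl_apply [simp]: "scl c x g = c * x g"
  by (simp add: scl_def)

lemma scl_scl [simp]: "scl a (scl b x) = scl (a * b) x"
  by (simp add: scl_def mult.assoc)

lemma scl_one [simp]: "scl 1 x = x"
  by (simp add: scl_def)

lemma scl_zero [simp]: "scl 0 x = 0" "scl c 0 = 0"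
  by (simp_all add: fun_eq_iff)

lemma scl_eq_0_iff: "scl c x = 0 \<longleftrightarrow> c = 0 \<or> x = 0"
  by (auto simp: fun_eq_iff)

lemma scl_add_left: "scl (a + b) x = scl a x + scl b x"
  by (simp add: fun_eq_iff algebra_simps)

lemma scl_add_right: "scl a (x + y) = scl a x + scl a y"
  by (simp add: fun_eq_iff algebra_simps)

lemma scl_cancel: "scl a x = scl b x \<Longrightarrow> x \<noteq> 0 \<Longrightarrow> a = b"
  by (auto simp: fun_eq_iff)

lemma supported_closed [intro]:
  "supported K 0"
  "supported K x \<Longrightarrow> supported K (scl c x)"
  "supported K x \<Longrightarrow> supported K y \<Longrightarrow> supported K (x + y)"
  "supported K x \<Longrightarrow> supported K y \<Longrightarrow> supported K (x - y)"
  by (auto simp: supported_def)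

lemma supported_mono: "supported K x \<Longrightarrow> K \<subseteq> L \<Longrightarrow> supported L x"
  by (auto simp: supported_def)

locale finite_group = group G for G (structure) +
  assumes fin [simp, intro]: "finite (carrier G)"
begin

definition conv (infixl "\<star>" 70) where
  "x \<star> y = (\<lambda>g. if g \<in> carrier G then \<Sum>h\<in>carrier G. x h * y (inv h \<otimes> g) else (0::complex))"

definition star where
  "star x = (\<lambda>g. if g \<in> carrier G then cnj (x (inv g)) else 0)"

lemma subgroup_sum_mult_right:
  assumes K: "subgroup K G" and k: "k \<in> K" shows "(\<Sum>h\<in>K. f (h \<otimes> k)) = (\<Sum>h\<in>K. f h)"
proof -
  interpret K: subgroup K G by (rule K)
  show ?thesis
    by (rule sum.reindex_bij_witness[of _ "\<lambda>h. h \<otimes> inv k" "\<lambda>h. h \<otimes> k"])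
       (use k in \<open>auto simp: m_assoc\<close>)
qed

lemma subgroup_sum_mult_left:
  assumes K: "subgroup K G" and k: "k \<in> K" shows "(\<Sum>h\<in>K. f (k \<otimes> h)) = (\<Sum>h\<in>K. f h)"
proof -
  interpret K: subgroup K G by (rule K)
  show ?thesis
    by (rule sum.reindex_bij_witness[of _ "\<lambda>h. inv k \<otimes> h" "\<lambda>h. k \<otimes> h"])
       (use k in \<open>auto simp: m_assoc[symmetric]\<close>)
qed

lemma subgroup_sum_inv:
  assumes K: "subgroup K G" shows "(\<Sum>h\<in>K. f (inv h)) = (\<Sum>h\<in>K. f h)"
proof -
  interpret K: subgroup K G by (rule K)
  show ?thesis by (rule sum.reindex_bij_witness[of _ "\<lambda>h. inv h" "\<lambda>h. inv h"]) auto
qed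

lemma conv_outside [simp]: "g \<notin> carrier G \<Longrightarrow> (x \<star> y) g = 0"
  by (simp add: conv_def)

lemma conv_assoc: "(x \<star> y) \<star> z = x \<star> (y \<star> z)"
proof
  fix g
  show "((x \<star> y) \<star> z) g = (x \<star> (y \<star> z)) g"
  proof (cases "g \<in> carrier G")
    case True
    have "((x \<star> y) \<star> z) g =
        (\<Sum>h\<in>carrier G. \<Sum>k\<in>carrier G. x k * (y (inv k \<otimes> h) * z (inv h \<otimes> g)))"
      using True by (simp add: conv_def sum_distrib_right mult.assoc)
    also have "\<dots> = (\<Sum>k\<in>carrier G. \<Sum>h\<in>carrier G. x k * (y (inv k \<otimes> h) * z (inv h \<otimes> g)))"
      by (rule sum.swap)
    also have "\<dots> = (\<Sum>k\<in>carrier G. x k * (\<Sum>h\<in>carrier G. y h * z (inv h \<otimes> (inv k \<otimes> g))))"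
    proof (rule sum.cong [OF refl])
      fix k assume k: "k \<in> carrier G"
      have "(\<Sum>h\<in>carrier G. x k * (y (inv k \<otimes> h) * z (inv h \<otimes> g))) =
          (\<Sum>h\<in>carrier G. x k * (y (inv k \<otimes> (k \<otimes> h)) * z (inv (k \<otimes> h) \<otimes> g)))"
        by (rule subgroup_sum_mult_left[OF subgroup_self k, symmetric])
      also have "\<dots> = (\<Sum>h\<in>carrier G. x k * (y h * z (inv h \<otimes> (inv k \<otimes> g))))"
        using k True by (intro sum.cong refl) (auto simp: m_assoc[symmetric] inv_mult_group)
      finally show "(\<Sum>h\<in>carrier G. x k * (y (inv k \<otimes> h) * z (inv h \<otimes> g))) =
          x k * (\<Sum>h\<in>carrier G. y h * z (inv h \<otimes> (inv k \<otimes> g)))"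
        by (simp add: sum_distrib_left)
    qed
    also have "\<dots> = (x \<star> (y \<star> z)) g"
      using True by (simp add: conv_def)
    finally show ?thesis .
  qed simp
qed

lemma conv_linear:
  "(x + y) \<star> z = x \<star> z + y \<star> z" "x \<star> (y + z) = x \<star> y + x \<star> z"
  "(x - y) \<star> z = x \<star> z - y \<star> z" "x \<star> (y - z) = x \<star> y - x \<star> z"
  "scl c x \<star> y = scl c (x \<star> y)" "x \<star> scl c y = scl c (x \<star> y)"
  by (auto simp: conv_def fun_eq_iff sum.distrib sum_subtractf algebra_simps sum_distrib_left)

lemma conv_zero [simp]: "0 \<star> x = 0" "x \<star> 0 = 0"
  by (auto simp: conv_def fun_eq_iff)

lemma supported_conv:
  assumes "subgroup K G" "supported K x" "supported K y" shows "supported K (x \<star> y)"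
  unfolding supported_def
proof (intro allI impI)
  fix g assume g: "g \<notin> K"
  show "(x \<star> y) g = 0"
  proof (cases "g \<in> carrier G")
    case True
    have "x h * y (inv h \<otimes> g) = 0" if h: "h \<in> carrier G" for h
    proof (cases "h \<in> K")
      case hK: True
      have "inv h \<otimes> g \<notin> K"
      proof
        assume "inv h \<otimes> g \<in> K"
        then have "h \<otimes> (inv h \<otimes> g) \<in> K"
          using hK assms(1) by (simp add: subgroup.m_closed)
        then show False
          using g True h by (simp add: m_assoc[symmetric])
      qed
      then show ?thesis using assms(3) by (simp add: supported_def)
    qed (use assms(2) in \<open>simp add: supported_def\<close>)
    then show ?thesis by (simp add: conv_def del: mult_eq_0_iff)
  qed simp
qed

lemma supported_star: "subgroup K G \<Longrightarrow> supported K x \<Longrightarrow> supported K (star x)"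
  using subgroup.m_inv_closed[of K G] inv_inv by (force simp: supported_def star_def)

lemma star_star: "supported (carrier G) x \<Longrightarrow> star (star x) = x"
  by (auto simp: star_def supported_def fun_eq_iff)

lemma star_linear:
  "star (x + y) = star x + star y" "star (x - y) = star x - star y"
  "star (scl c x) = scl (cnj c) (star x)" "star 0 = 0"
  by (auto simp: star_def fun_eq_iff)

lemma star_conv: "star (x \<star> y) = star y \<star> star x"
proof
  fix g
  show "star (x \<star> y) g = (star y \<star> star x) g"
  proof (cases "g \<in> carrier G")
    case True
    have "star (x \<star> y) g = (\<Sum>h\<in>carrier G. cnj (x h * y (inv h \<otimes> inv g)))"
      using True by (simp add: conv_def star_def)
    also have "\<dots> = (\<Sum>h\<in>carrier G. cnj (x (inv (inv h \<otimes> g)) * y (inv (inv (inv h \<otimes> g)) \<otimes> inv g)))"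
      using True subgroup_sum_inv[OF subgroup_self, of "\<lambda>h. cnj (x (inv (h \<otimes> g)) * y (inv (inv (h \<otimes> g)) \<otimes> inv g))"]
        subgroup_sum_mult_right[OF subgroup_self, of g "\<lambda>h. cnj (x (inv h) * y (inv (inv h) \<otimes> inv g))"]
        subgroup_sum_inv[OF subgroup_self, of "\<lambda>h. cnj (x h * y (inv h \<otimes> inv g))"] by simp
    also have "\<dots> = (star y \<star> star x) g"
      using True
      by (auto simp: conv_def star_def mult.commute m_assoc intro!: sum.cong)
    finally show ?thesis .
  qed (simp add: star_def)
qed

lemma conv_one_commute: "(x \<star> y) \<one> = (y \<star> x) \<one>"
  using subgroup_sum_inv[OF subgroup_self, of "\<lambda>h. x h * y (inv h)"] by (simp add: conv_def mult.commute cong: sum.cong)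

definition sqnorm where "sqnorm x = (\<Sum>g\<in>carrier G. (cmod (x g))\<^sup>2)"

text \<open>Evaluation at \<open>\<one>\<close> is a trace by \<open>conv_one_commute\<close>;
  positivity makes it faithful, so non-zero elements and scalars can be recognised by evaluating
  there.\<close>

lemma conv_star_one: "(x \<star> star x) \<one> = of_real (sqnorm x)" "(star x \<star> x) \<one> = of_real (sqnorm x)"
proof -
  show "(x \<star> star x) \<one> = of_real (sqnorm x)"
    unfolding sqnorm_def of_real_sum complex_norm_square by (simp add: conv_def star_def cong: sum.cong)
  then show "(star x \<star> x) \<one> = of_real (sqnorm x)"
    by (simp add: conv_one_commute)
qed

lemma sqnorm_nonneg: "0 \<le> sqnorm x"
  by (simp add: sqnorm_def sum_nonneg)

lemma sqnorm_eq_0: "supported (carrier G) x \<Longrightarrow> sqnorm x = 0 \<Longrightarrow> x = 0"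
  by (auto simp: sqnorm_def sum_nonneg_eq_0_iff supported_def fun_eq_iff)

lemma sqnorm_pos: "supported (carrier G) x \<Longrightarrow> x \<noteq> 0 \<Longrightarrow> 0 < sqnorm x"
  using sqnorm_eq_0[of x] sqnorm_nonneg[of x] by linarith

definition delta where "delta a = (\<lambda>g. if g = a then 1 else (0::complex))"

lemma conv_delta_left:
  assumes "a \<in> carrier G" "g \<in> carrier G" shows "(delta a \<star> x) g = x (inv a \<otimes> g)"
  using assms by (simp add: conv_def delta_def if_distrib[of "\<lambda>u. u * _"] sum.delta cong: if_cong)

lemma conv_delta_right:
  assumes "a \<in> carrier G" "g \<in> carrier G" shows "(x \<star> delta a) g = x (g \<otimes> inv a)"
proof -
  have "inv h \<otimes> g = a \<longleftrightarrow> h = g \<otimes> inv a" if "h \<in> carrier G" for h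
    using assms that by (metis inv_closed inv_solve_left inv_solve_right)
  then show ?thesis
    using assms by (simp add: conv_def delta_def if_distrib[of "\<lambda>u. _ * u"] sum.delta cong: if_cong sum.cong)
qed

lemma conv_delta_one:
  assumes "supported (carrier G) x" shows "delta \<one> \<star> x = x" "x \<star> delta \<one> = x"
proof -
  have "(delta \<one> \<star> x) g = x g \<and> (x \<star> delta \<one>) g = x g" for g
    using assms by (cases "g \<in> carrier G") (simp_all add: conv_delta_left conv_delta_right supported_def)
  then show "delta \<one> \<star> x = x" "x \<star> delta \<one> = x" by auto
qed

section \<open>Primitive projections\<close>

definition projection where
  "projection K p \<longleftrightarrow> supported K p \<and> p \<star> p = p \<and> star p = p"

text \<open>Schur's lemma built in: \<open>p \<star> A \<star> p\<close> is anti-isomorphic to the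
  endomorphism ring of the left ideal generated by \<open>p\<close>, and this ring being the scalars
  means that the ideal is irreducible.\<close>

definition primitive where
  "primitive K p \<longleftrightarrow> projection K p \<and> p \<noteq> 0 \<and>
     (\<forall>x. supported K x \<longrightarrow> (\<exists>c. p \<star> x \<star> p = scl c p))"

lemma projection_one:
  assumes "projection K p" "K \<subseteq> carrier G" shows "p \<one> = of_real (sqnorm p)"
  using conv_star_one(1)[of p] assms by (simp add: projection_def)

text \<open>Evaluating \<open>p \<star> p = p\<close> where \<open>cmod (p g)\<close> is largest
  shows that the sum of the moduli is at least 1; passing to squares costs a factor |G|. The bound
  guarantees that splitting projections terminates.\<close>

lemma projection_one_ge:
  assumes "projection K p" "K \<subseteq> carrier G" "p \<noteq> 0" shows "1 / card (carrier G) \<le> sqnorm p"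
proof -
  have sp: "supported (carrier G) p" using assms supported_mono by (auto simp: projection_def)
  obtain a where a: "a \<in> carrier G" "\<And>g. g \<in> carrier G \<Longrightarrow> cmod (p g) \<le> cmod (p a)"
  proof -
    have "Max ((\<lambda>g. cmod (p g)) ` carrier G) \<in> (\<lambda>g. cmod (p g)) ` carrier G"
      by (intro Max_in) auto
    then obtain a where "a \<in> carrier G" "cmod (p a) = Max ((\<lambda>g. cmod (p g)) ` carrier G)" by auto
    then show ?thesis using that by simp
  qed
  let ?m = "cmod (p a)" and ?n = "real (card (carrier G))"
  obtain g where "g \<in> carrier G" "p g \<noteq> 0"
    using assms(3) sp by (auto simp: supported_def fun_eq_iff)
  then have "?m > 0" using a(2)[of g] by (metis zero_less_norm_iff norm_ge_zero order_less_le_trans)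
  have "(p \<star> p) a = p a" using assms(1) by (simp add: projection_def)
  then have "?m = cmod (\<Sum>h\<in>carrier G. p h * p (inv h \<otimes> a))"
    using a(1) by (simp add: conv_def)
  also have "\<dots> \<le> (\<Sum>h\<in>carrier G. cmod (p h) * ?m)"
    by (rule order_trans[OF norm_sum]) (use a in \<open>auto simp: norm_mult intro!: sum_mono mult_left_mono\<close>)
  also have "\<dots> = (\<Sum>h\<in>carrier G. cmod (p h)) * ?m" by (simp add: sum_distrib_right)
  finally have "1 \<le> (\<Sum>h\<in>carrier G. cmod (p h))" using \<open>?m > 0\<close> by simp
  moreover have "?n > 0" using one_closed fin card_gt_0_iff by fastforce
  \<comment> \<open>This is the expanded square of \<open>?n * cmod (p h) - 1\<close>, a substitute
    for the Cauchy-Schwarz inequality.\<close>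
  moreover have "(\<Sum>h\<in>carrier G. 2 * ?n * cmod (p h)) \<le> (\<Sum>h\<in>carrier G. ?n\<^sup>2 * (cmod (p h))\<^sup>2 + 1)"
  proof (rule sum_mono)
    fix h
    show "2 * ?n * cmod (p h) \<le> ?n\<^sup>2 * (cmod (p h))\<^sup>2 + 1"
      using sum_squares_ge_zero[of "?n * cmod (p h) - 1" 0] by (simp add: power2_eq_square algebra_simps)
  qed
  then have "2 * ?n * (\<Sum>h\<in>carrier G. cmod (p h)) \<le> ?n\<^sup>2 * sqnorm p + ?n"
    by (simp add: sqnorm_def sum.distrib sum_distrib_left)
  moreover have "2 * ?n * 1 \<le> 2 * ?n * (\<Sum>h\<in>carrier G. cmod (p h))"
    using \<open>1 \<le> _\<close> by (intro mult_left_mono) auto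
  ultimately have "2 * ?n * 1 \<le> ?n\<^sup>2 * sqnorm p + ?n" by linarith
  then have "?n * 1 \<le> ?n * (?n * sqnorm p)" by (simp add: power2_eq_square)
  then have "1 \<le> ?n * sqnorm p" using \<open>?n > 0\<close> by (rule mult_left_le_imp_le)
  then show ?thesis using \<open>?n > 0\<close> by (simp add: divide_le_eq mult.commute)
qed

text \<open>Evaluation of a polynomial at \<open>y\<close> in the corner algebra with unit element \<open>p\<close>.\<close>

definition ev where
  "ev p y r = fold_coeffs (\<lambda>a f. scl a p + y \<star> f) r 0"

lemma ev_0 [simp]: "ev p y 0 = 0"
  by (simp add: ev_def)

lemma ev_pCons [simp]: "ev p y (pCons a r) = scl a p + y \<star> ev p y r"
  by (cases "r = 0"; cases "a = 0") (simp_all add: ev_def)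

lemma ev_add: "ev p y (r + s) = ev p y r + ev p y s"
proof (induction r s rule: poly_induct2)
  case (pCons a r b s)
  show ?case
    by (simp only: add_pCons ev_pCons pCons conv_linear scl_add_left) (simp only: ac_simps)
qed simp

lemma ev_smult: "ev p y (smult c r) = scl c (ev p y r)"
proof (induction r)
  case (pCons a r)
  show ?case
    by (simp only: smult_pCons ev_pCons pCons conv_linear scl_add_right scl_scl)
qed simp

lemma ev_smult_diff: "ev p y (r - smult c s) = ev p y r - scl c (ev p y s)"
  using ev_add[of p y r "smult (-c) s"] ev_smult[of p y "-c" s] by (simp add: fun_eq_iff)

lemma ev_supported: "subgroup K G \<Longrightarrow> supported K p \<Longrightarrow> supported K y \<Longrightarrow> supported K (ev p y r)"
  by (induction r) (auto intro: supported_conv)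

text \<open>Asking for large degree instead of bounding it makes the induction over the linear conditions
  immediate: two solutions of different degrees can be combined to satisfy one more condition.\<close>

lemma ex_annihilating_poly_large:
  assumes "finite S" shows "\<exists>r. m \<le> degree r \<and> r \<noteq> 0 \<and> (\<forall>g\<in>S. ev p y r g = 0)"
  using assms
proof (induction S arbitrary: m)
  case empty
  then show ?case
    by (intro exI[of _ "monom 1 m"]) (simp add: degree_monom_eq)
next
  case (insert a S)
  obtain r1 where r1: "m \<le> degree r1" "r1 \<noteq> 0" "\<forall>g\<in>S. ev p y r1 g = 0" using insert.IH by blast
  obtain r2 where r2: "Suc (degree r1) \<le> degree r2" "r2 \<noteq> 0" "\<forall>g\<in>S. ev p y r2 g = 0"
    using insert.IH by blast
  show ?case
  proof (cases "ev p y r1 a = 0")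
    case False
    define r where "r = r2 - smult (ev p y r2 a / ev p y r1 a) r1"
    have "degree (smult (ev p y r2 a / ev p y r1 a) r1) < degree r2"
      using r2(1) degree_smult_le[of _ r1] le_less_trans by (metis Suc_le_eq)
    then have "degree r = degree r2" unfolding r_def by (rule degree_diff_eq_left)
    moreover from this have "r \<noteq> 0" using r2(1) by auto
    ultimately show ?thesis
      using r1 r2 False by (intro exI[of _ r]) (auto simp: r_def ev_smult_diff)
  qed (use r1 in auto)
qed

text \<open>Take an annihilating polynomial of least degree and split off a root \<open>l\<close>:
  the cofactor evaluated at \<open>y\<close> is non-zero by minimality and is killed by
  \<open>y - l\<close>. That the eigenvector is a polynomial in \<open>y\<close> matters
  later.\<close>

lemma ex_eigenvector:
  assumes K: "subgroup K G" and p: "supported K p" "p \<noteq> 0" and y: "supported K y" and yp: "y \<star> p = y"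
  shows "\<exists>r l. ev p y r \<noteq> 0 \<and> y \<star> ev p y r = scl l (ev p y r)"
proof -
  have "\<exists>r. r \<noteq> 0 \<and> ev p y r = 0"
  proof -
    obtain r where r: "r \<noteq> 0" "\<forall>g\<in>carrier G. ev p y r g = 0"
      using ex_annihilating_poly_large[of "carrier G"] by blast
    have "supported K (ev p y r)" using ev_supported K p y by blast
    then have "ev p y r = 0" using r(2) subgroup.subset[OF K] by (auto simp: supported_def fun_eq_iff)
    with r show ?thesis by blast
  qed
  then obtain r where r: "r \<noteq> 0" "ev p y r = 0" "\<And>s. s \<noteq> 0 \<Longrightarrow> ev p y s = 0 \<Longrightarrow> degree r \<le> degree s"
    using ex_has_least_nat[of "\<lambda>r. r \<noteq> 0 \<and> ev p y r = 0" _ degree] by blast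
  \<comment> \<open>A non-zero constant polynomial evaluates to a non-zero multiple of
    \<open>p\<close>, so it does not annihilate; hence \<open>r\<close> has a root.\<close>
  have "\<not> (\<exists>a l. a \<noteq> 0 \<and> l = 0 \<and> r = pCons a l)"
    using r(2) p(2) by (auto simp: scl_eq_0_iff)
  then obtain l where "poly r l = 0" using fundamental_theorem_of_algebra_alt by blast
  then obtain s where s: "r = [:-l, 1:] * s" by (auto simp: poly_eq_0_iff_dvd)
  then have "s \<noteq> 0" using r(1) by auto
  then have "degree r = Suc (degree s)" unfolding s by (subst degree_mult_eq) auto
  then have "ev p y s \<noteq> 0" using r(3)[OF \<open>s \<noteq> 0\<close>] by auto
  moreover have "ev p y r = y \<star> ev p y s - scl l (ev p y s)"
    by (simp add: s ev_smult_diff)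
  ultimately show ?thesis using r(2) by (intro exI[of _ s] exI[of _ l]) simp
qed

lemma ev_left_unit: "p \<star> p = p \<Longrightarrow> p \<star> y = y \<Longrightarrow> p \<star> ev p y r = ev p y r"
  by (induction r) (simp_all only: ev_0 ev_pCons conv_linear conv_zero conv_assoc[symmetric])

lemma ev_eigenvector:
  assumes "p \<star> v = v" "y \<star> v = scl l v"
  shows "\<exists>c. ev p y s \<star> v = scl c v"
proof (induction s)
  case 0
  show ?case by (intro exI[of _ 0]) (simp only: ev_0 conv_zero scl_zero)
next
  case (pCons a s)
  then obtain c where c: "ev p y s \<star> v = scl c v" by blast
  have "ev p y (pCons a s) \<star> v = scl a (p \<star> v) + y \<star> (ev p y s \<star> v)"
    by (simp only: ev_pCons conv_linear conv_assoc)
  also have "\<dots> = scl (a + c * l) v"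
    by (simp only: c assms conv_linear scl_scl scl_add_left)
  finally show ?case by blast
qed

text \<open>The star of a polynomial in a self-adjoint \<open>y\<close> is again a polynomial in
  \<open>y\<close>, with conjugated coefficients, and so acts on an eigenvector of \<open>y\<close>
  by a scalar.\<close>

lemma star_ev_eigenvector:
  assumes "p \<star> v = v" "y \<star> v = scl l v" "star p = p" "star y = y"
  shows "\<exists>c. star (ev p y s) \<star> v = scl c v"
proof (induction s)
  case 0
  show ?case by (intro exI[of _ 0]) (simp only: ev_0 star_linear conv_zero scl_zero)
next
  case (pCons a s)
  then obtain c where c: "star (ev p y s) \<star> v = scl c v" by blast
  have "star (ev p y (pCons a s)) \<star> v = scl (cnj a) (p \<star> v) + star (ev p y s) \<star> (y \<star> v)"
    by (simp only: ev_pCons conv_linear conv_assoc star_linear star_conv assms(3,4))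
  also have "\<dots> = scl (cnj a + l * c) v"
    by (simp only: c assms(1,2) conv_linear scl_scl scl_add_left)
  finally show ?case by blast
qed

text \<open>\<open>p \<star> x \<star> p\<close> is a combination of its self-adjoint real and
  imaginary parts; were both multiples of \<open>p\<close>, it would be one too.\<close>

lemma ex_selfadjoint_nonscalar:
  assumes K: "subgroup K G" and p: "projection K p" and x: "supported K x" "\<And>c. p \<star> x \<star> p \<noteq> scl c p"
  shows "\<exists>y. supported K y \<and> star y = y \<and> p \<star> y = y \<and> y \<star> p = y \<and> (\<forall>c. y \<noteq> scl c p)"
proof -
  have KG: "K \<subseteq> carrier G" by (rule subgroup.subset[OF K])
  have pp: "supported K p" "p \<star> p = p" "star p = p" using p by (auto simp: projection_def)
  define z where "z = p \<star> x \<star> p"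
  have z: "supported K z" "p \<star> z = z" "z \<star> p = z"
    using pp x(1) supported_conv[OF K] by (auto simp: z_def conv_assoc) (simp_all add: conv_assoc[symmetric])
  have zs: "supported K (star z)" "p \<star> star z = star z" "star z \<star> p = star z" "star (star z) = z"
    using z pp supported_star[OF K] star_conv[of p z] star_conv[of z p] star_star supported_mono[OF _ KG] by auto
  define y1 where "y1 = z + star z"
  define y2 where "y2 = scl \<i> (z - star z)"
  have y1: "supported K y1" "star y1 = y1" "p \<star> y1 = y1" "y1 \<star> p = y1"
    unfolding y1_def using z zs by (auto simp: star_linear conv_linear add.commute)
  have y2: "supported K y2" "star y2 = y2" "p \<star> y2 = y2" "y2 \<star> p = y2"
  proof -
    show "supported K y2" unfolding y2_def using z zs by auto
    show "star y2 = y2" unfolding y2_def by (simp only: star_linear zs) (simp add: fun_eq_iff algebra_simps)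
    show "p \<star> y2 = y2" "y2 \<star> p = y2" unfolding y2_def by (simp_all only: conv_linear z zs)
  qed
  have "\<not> (y1 = scl c1 p \<and> y2 = scl c2 p)" for c1 c2
  proof
    assume "y1 = scl c1 p \<and> y2 = scl c2 p"
    then have "z + star z = scl c1 p" "scl \<i> (z - star z) = scl c2 p" by (auto simp: y1_def y2_def)
    then have e: "z g + star z g = c1 * p g" "\<i> * (z g - star z g) = c2 * p g" for g
      by (metis plus_fun_apply scl_apply) (metis \<open>scl \<i> (z - star z) = scl c2 p\<close> fun_diff_def scl_apply)
    have "z g = (c1 / 2 + c2 / (2 * \<i>)) * p g" for g
    proof -
      have "2 * \<i> * z g = \<i> * (z g + star z g) + \<i> * (z g - star z g)" by (simp add: algebra_simps)
      then have "2 * \<i> * z g = \<i> * c1 * p g + c2 * p g" by (simp only: e mult.assoc)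
      then show ?thesis by (simp add: field_simps)
    qed
    then have "z = scl (c1 / 2 + c2 / (2 * \<i>)) p" by (simp add: fun_eq_iff)
    then show False using x(2) by (simp add: z_def)
  qed
  then show ?thesis using y1 y2 by blast
qed

text \<open>A polynomial \<open>v\<close> in a self-adjoint \<open>y\<close> that is an eigenvector of \<open>y\<close> makes \<open>star v \<star> v\<close> a
  multiple of a projection, which differs from \<open>p\<close> because \<open>y\<close> is not a multiple of \<open>p\<close>.\<close>

lemma split_projection:
  assumes K: "subgroup K G" and p: "projection K p" "p \<noteq> 0" and np: "\<not> primitive K p"
  shows "\<exists>q. projection K q \<and> projection K (p - q) \<and> q \<noteq> 0 \<and> q \<noteq> p"
proof -
  have KG: "K \<subseteq> carrier G" by (rule subgroup.subset[OF K])
  have pp: "supported K p" "p \<star> p = p" "star p = p" using p by (auto simp: projection_def)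
  obtain y where y: "supported K y" "star y = y" "p \<star> y = y" "y \<star> p = y" "\<And>c. y \<noteq> scl c p"
    using np p ex_selfadjoint_nonscalar[OF K p(1)] unfolding primitive_def by blast
  obtain r l where rl: "ev p y r \<noteq> 0" "y \<star> ev p y r = scl l (ev p y r)"
    using ex_eigenvector[OF K pp(1) p(2) y(1,4)] by blast
  define v where "v = ev p y r"
  have sv: "supported K v" unfolding v_def by (rule ev_supported[OF K pp(1) y(1)])
  have pv: "p \<star> v = v" unfolding v_def by (rule ev_left_unit[OF pp(2) y(3)])
  have yv: "y \<star> v = scl l v" "v \<noteq> 0" using rl by (simp_all add: v_def)
  obtain c where c: "star v \<star> v = scl c v"
    using star_ev_eigenvector[OF pv yv(1) pp(3) y(2), of r] by (auto simp: v_def)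
  obtain c' where c': "v \<star> v = scl c' v"
    using ev_eigenvector[OF pv yv(1), of r] by (auto simp: v_def)
  define w where "w = star v \<star> v"
  have w: "supported K w" "star w = w" "w = scl c v"
    by (auto simp only: w_def star_conv star_star[OF supported_mono[OF sv KG]]
        intro: supported_conv[OF K supported_star[OF K sv] sv]) (simp only: c)
  have w1: "w \<one> = of_real (sqnorm v)" unfolding w_def by (rule conv_star_one)
  have posv: "sqnorm v > 0" using sqnorm_pos supported_mono[OF sv KG] yv(2) by blast
  have "w \<noteq> 0" using w1 posv by auto
  then have posw: "sqnorm w > 0" using sqnorm_pos supported_mono[OF w(1) KG] by blast
  have ww: "w \<star> w = scl (c * c') w"
    by (simp only: w(3) conv_linear c' scl_scl) (simp only: ac_simps)
  \<comment> \<open>Comparing traces identifies the factor \<open>c * c'\<close> as a quotient of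
    squared norms, hence real and positive; dividing \<open>w\<close> by it gives an idempotent that
    is still self-adjoint.\<close>
  then have "(w \<star> w) \<one> = c * c' * w \<one>" by simp
  then have "c * c' * of_real (sqnorm v) = of_real (sqnorm w)"
    using conv_star_one(1)[of w] by (simp only: w(2) w1)
  then have k: "c * c' = of_real (sqnorm w / sqnorm v)"
    using posv by (simp add: field_simps)
  define k where "k = sqnorm w / sqnorm v"
  have k0: "k > 0" using posv posw by (simp add: k_def)
  define q where "q = scl (of_real (1 / k)) w"
  have q: "supported K q" "q \<noteq> 0" "star q = q"
    using w(1,2) \<open>w \<noteq> 0\<close> k0 by (auto simp: q_def scl_eq_0_iff star_linear)
  have qq: "q \<star> q = q"
    unfolding q_def using k0 by (simp only: conv_linear ww k k_def[symmetric] scl_scl of_real_mult[symmetric]) simp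
  have pq: "p \<star> q = q" by (simp only: q_def w(3) conv_linear pv)
  then have qp: "q \<star> p = q" using star_conv[of p q] by (simp only: q pp)
  have yq: "y \<star> q = scl l q" by (simp only: q_def w(3) conv_linear yv scl_scl ac_simps)
  \<comment> \<open>If \<open>q = p\<close>, then \<open>y = y \<star> p = scl l p\<close>, contrary
    to the choice of \<open>y\<close>.\<close>
  have "q \<noteq> p" using yq y(4,5) by metis
  moreover have "projection K (p - q)"
  proof -
    have "(p - q) \<star> (p - q) = p - q" by (simp only: conv_linear pp qq pq qp) simp
    then show ?thesis using pp q by (auto simp: projection_def star_linear)
  qed
  ultimately show ?thesis using q qq by (auto simp: projection_def)
qed

text \<open>Squared norms of projections are values at \<open>\<one>\<close>, so they add up under
  splitting; scaled by |G| each non-zero part is at least 1, and the integer part strictly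
  decreases.\<close>

lemma projection_eq_sum_primitive:
  assumes K: "subgroup K G" and p: "projection K p"
  shows "\<exists>fs. (\<forall>f\<in>set fs. primitive K f) \<and> p = sum_list fs"
  using p
proof (induction "nat \<lfloor>sqnorm p * card (carrier G)\<rfloor>" arbitrary: p rule: less_induct)
  case less
  have KG: "K \<subseteq> carrier G" by (rule subgroup.subset[OF K])
  consider "p = 0" | "primitive K p" | "p \<noteq> 0" "\<not> primitive K p" by blast
  then show ?case
  proof cases
    case 1
    then show ?thesis by (intro exI[of _ "[]"]) (simp add: zero_fun_def)
  next
    case 2
    then show ?thesis by (intro exI[of _ "[p]"]) simp
  next
    case 3
    obtain q where q: "projection K q" "projection K (p - q)" "q \<noteq> 0" "q \<noteq> p"
      using split_projection[OF K less.prems 3] by blast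
    let ?n = "real (card (carrier G))"
    have n: "?n > 0" using one_closed fin card_gt_0_iff by fastforce
    have "complex_of_real (sqnorm p) = of_real (sqnorm q + sqnorm (p - q))"
      using projection_one[OF less.prems KG] projection_one[OF q(1) KG] projection_one[OF q(2) KG]
      by (simp add: algebra_simps)
    then have add: "sqnorm p = sqnorm q + sqnorm (p - q)" by (simp only: of_real_eq_iff)
    have "p - q \<noteq> 0" using q(4) by simp
    have "sqnorm q * ?n \<ge> 1" "sqnorm (p - q) * ?n \<ge> 1"
      using projection_one_ge[OF q(1) KG q(3)] projection_one_ge[OF q(2) KG \<open>p - q \<noteq> 0\<close>] n
      by (simp_all add: divide_le_eq)
    then have "nat \<lfloor>sqnorm q * ?n\<rfloor> < nat \<lfloor>sqnorm p * ?n\<rfloor>" "nat \<lfloor>sqnorm (p - q) * ?n\<rfloor> < nat \<lfloor>sqnorm p * ?n\<rfloor>"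
      unfolding add distrib_right by linarith+
    then obtain fs gs where "\<forall>f\<in>set fs. primitive K f" "q = sum_list fs"
        "\<forall>f\<in>set gs. primitive K f" "p - q = sum_list gs"
      using less.hyps q(1,2) by meson
    then show ?thesis by (intro exI[of _ "fs @ gs"]) (auto simp: algebra_simps)
  qed
qed

lemma projection_delta_one: "subgroup K G \<Longrightarrow> projection K (delta \<one>)"
  using conv_delta_one[of "delta \<one>"] subgroup.one_closed[of K G]
  by (auto simp: projection_def supported_def delta_def star_def fun_eq_iff)

section \<open>Class functions\<close>

definition class_fun where
  "class_fun K z \<longleftrightarrow> supported K z \<and> (\<forall>k\<in>K. \<forall>g\<in>K. z (k \<otimes> g \<otimes> inv k) = (z g :: complex))"

text \<open>For a primitive projection \<open>p\<close> the function \<open>cl K p\<close> is the complex conjugate of the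
  irreducible character afforded by the left ideal generated by \<open>p\<close>.\<close>

definition cl where
  "cl K x = (\<lambda>g. if g \<in> K then \<Sum>k\<in>K. x (k \<otimes> g \<otimes> inv k) else (0::complex))"

definition cip where
  "cip K z w = (\<Sum>g\<in>K. z g * cnj (w g)) / of_nat (card K)"

lemma conj_conj:
  assumes "k \<in> carrier G" "h \<in> carrier G" "g \<in> carrier G"
  shows "k \<otimes> (h \<otimes> g \<otimes> inv h) \<otimes> inv k = (k \<otimes> h) \<otimes> g \<otimes> inv (k \<otimes> h)"
  using assms by (simp add: m_assoc inv_mult_group)

lemma subgroup_sum_conj:
  assumes K: "subgroup K G" and k: "k \<in> K" shows "(\<Sum>h\<in>K. f (k \<otimes> h \<otimes> inv k)) = (\<Sum>h\<in>K. f h)"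
proof -
  interpret K: subgroup K G by (rule K)
  have "inv k \<otimes> (k \<otimes> a \<otimes> inv k) \<otimes> k = a" "k \<otimes> (inv k \<otimes> a \<otimes> k) \<otimes> inv k = a" if "a \<in> K" for a
    using conj_conj[of "inv k" k a] conj_conj[of k "inv k" a] k that by auto
  then show ?thesis
    by (intro sum.reindex_bij_witness[of _ "\<lambda>h. inv k \<otimes> h \<otimes> k" "\<lambda>h. k \<otimes> h \<otimes> inv k"])
       (use k in auto)
qed

lemma finite_subgroup: "subgroup K G \<Longrightarrow> finite K" "subgroup K G \<Longrightarrow> card K > 0"
  using subgroup.subset[of K G] finite_subset[OF _ fin] subgroup.one_closed[of K G]
  by (auto simp: card_gt_0_iff)

lemma conv_eq_sum_subgroup:
  assumes K: "subgroup K G" and x: "supported K x" and g: "g \<in> carrier G"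
  shows "(x \<star> y) g = (\<Sum>h\<in>K. x h * y (inv h \<otimes> g))"
  using g x subgroup.subset[OF K]
  by (auto simp: conv_def supported_def intro!: sum.mono_neutral_right)

lemma class_fun_cl:
  assumes K: "subgroup K G" shows "class_fun K (cl K x)"
proof -
  interpret K: subgroup K G by (rule K)
  have "cl K x (h \<otimes> g \<otimes> inv h) = cl K x g" if "h \<in> K" "g \<in> K" for h g
  proof -
    have "cl K x (h \<otimes> g \<otimes> inv h) = (\<Sum>k\<in>K. x ((k \<otimes> h) \<otimes> g \<otimes> inv (k \<otimes> h)))"
      using that by (auto simp: cl_def conj_conj intro!: sum.cong)
    also have "\<dots> = cl K x g"
      using subgroup_sum_mult_right[OF K that(1), of "\<lambda>k. x (k \<otimes> g \<otimes> inv k)"] that by (simp add: cl_def)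
    finally show ?thesis .
  qed
  then show ?thesis by (auto simp: class_fun_def supported_def cl_def)
qed

lemma cl_linear:
  "cl K (x + y) = cl K x + cl K y" "cl K (x - y) = cl K x - cl K y" "cl K (scl c x) = scl c (cl K x)"
  "cl K 0 = 0"
  by (auto simp: cl_def fun_eq_iff sum.distrib sum_subtractf sum_distrib_left)

lemma cl_one:
  assumes K: "subgroup K G" shows "cl K x \<one> = of_nat (card K) * x \<one>"
proof -
  interpret K: subgroup K G by (rule K)
  show ?thesis by (simp add: cl_def cong: sum.cong)
qed

text \<open>Averaging over conjugation kills commutators. Its use is that
  \<open>a \<star> star a\<close> and \<open>star a \<star> a\<close> have the same average.\<close>

lemma cl_conv_commute:
  assumes K: "subgroup K G" and x: "supported K x" and y: "supported K y"
  shows "cl K (x \<star> y) = cl K (y \<star> x)"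
proof
  interpret K: subgroup K G by (rule K)
  fix g
  show "cl K (x \<star> y) g = cl K (y \<star> x) g"
  proof (cases "g \<in> K")
    case g: True
    have "cl K (x \<star> y) g = (\<Sum>h\<in>K. \<Sum>k\<in>K. x h * y (inv h \<otimes> (k \<otimes> g \<otimes> inv k)))"
      using g by (subst sum.swap) (auto simp: cl_def conv_eq_sum_subgroup[OF K x] intro!: sum.cong)
    also have "\<dots> = (\<Sum>h\<in>K. \<Sum>k\<in>K. x h * y (k \<otimes> g \<otimes> inv k \<otimes> inv h))"
    proof (rule sum.cong [OF refl])
      fix h assume h: "h \<in> K"
      have "(\<Sum>k\<in>K. x h * y (inv h \<otimes> (k \<otimes> g \<otimes> inv k))) =
          (\<Sum>k\<in>K. x h * y (inv h \<otimes> ((h \<otimes> k) \<otimes> g \<otimes> inv (h \<otimes> k))))"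
        by (rule subgroup_sum_mult_left[OF K h, symmetric])
      also have "\<dots> = (\<Sum>k\<in>K. x h * y (k \<otimes> g \<otimes> inv k \<otimes> inv h))"
        using h g by (intro sum.cong refl) (auto simp: inv_mult_group m_assoc[symmetric])
      finally show "(\<Sum>k\<in>K. x h * y (inv h \<otimes> (k \<otimes> g \<otimes> inv k))) =
          (\<Sum>k\<in>K. x h * y (k \<otimes> g \<otimes> inv k \<otimes> inv h))" .
    qed
    also have "\<dots> = (\<Sum>k\<in>K. \<Sum>h\<in>K. y h * x (inv h \<otimes> (k \<otimes> g \<otimes> inv k)))"
    proof (subst sum.swap, rule sum.cong [OF refl])
      fix k assume k: "k \<in> K"
      define u where "u = k \<otimes> g \<otimes> inv k"
      have u: "u \<in> K" using g k by (simp add: u_def)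
      show "(\<Sum>h\<in>K. x h * y (k \<otimes> g \<otimes> inv k \<otimes> inv h)) =
          (\<Sum>h\<in>K. y h * x (inv h \<otimes> (k \<otimes> g \<otimes> inv k)))"
        unfolding u_def[symmetric]
        by (rule sum.reindex_bij_witness[of _ "\<lambda>h. inv h \<otimes> u" "\<lambda>h. u \<otimes> inv h"])
           (use u in \<open>auto simp: inv_mult_group m_assoc\<close>, simp_all add: m_assoc[symmetric])
    qed
    also have "\<dots> = cl K (y \<star> x) g"
      using g by (auto simp: cl_def conv_eq_sum_subgroup[OF K y] intro!: sum.cong)
    finally show ?thesis .
  qed (simp add: cl_def)
qed

lemma cip_linear:
  "cip K (x + y) z = cip K x z + cip K y z" "cip K (x - y) z = cip K x z - cip K y z"
  "cip K (scl c x) z = c * cip K x z" "cip K 0 z = 0"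
  "cip K z (x + y) = cip K z x + cip K z y" "cip K z (x - y) = cip K z x - cip K z y"
  "cip K z (scl c x) = cnj c * cip K z x"
  by (simp_all add: cip_def sum.distrib sum_subtractf sum_distrib_left algebra_simps
      add_divide_distrib diff_divide_distrib)

lemma cip_commute: "cip K x y = cnj (cip K y x)"
  by (simp add: cip_def mult.commute)

lemma cip_self: "cip K x x = of_real ((\<Sum>g\<in>K. (cmod (x g))\<^sup>2) / card K)"
  unfolding cip_def of_real_divide of_real_sum complex_norm_square by simp

text \<open>A class function cannot distinguish \<open>x\<close> from its conjugates, so one side of
  the inner product need not be averaged.\<close>

lemma cip_cl:
  assumes K: "subgroup K G" and z: "class_fun K z"
  shows "cip K (cl K x) z = (\<Sum>g\<in>K. x g * cnj (z g))"
proof -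
  interpret K: subgroup K G by (rule K)
  have "(\<Sum>g\<in>K. cl K x g * cnj (z g)) = (\<Sum>k\<in>K. \<Sum>g\<in>K. x (k \<otimes> g \<otimes> inv k) * cnj (z g))"
    by (subst sum.swap) (simp add: cl_def sum_distrib_right)
  also have "\<dots> = (\<Sum>k\<in>K. \<Sum>g\<in>K. x (k \<otimes> g \<otimes> inv k) * cnj (z (k \<otimes> g \<otimes> inv k)))"
    using z by (intro sum.cong refl) (simp add: class_fun_def)
  also have "\<dots> = (\<Sum>k\<in>K. \<Sum>g\<in>K. x g * cnj (z g))"
    by (intro sum.cong refl subgroup_sum_conj[OF K, where f = "\<lambda>g. x g * cnj (z g)"])
  finally show ?thesis using finite_subgroup(2)[OF K] by (simp add: cip_def)
qed

section \<open>Orthogonality relations\<close>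

lemma conv_one_supported:
  assumes K: "subgroup K G" and x: "supported K x"
  shows "(x \<star> y) \<one> = (\<Sum>h\<in>K. x h * y (inv h))"
  using subgroup.subset[OF K] by (auto simp: conv_eq_sum_subgroup[OF K x] intro!: sum.cong)

lemma star_delta: "a \<in> carrier G \<Longrightarrow> star (delta a) = delta (inv a)"
  using inv_inv by (auto simp: star_def delta_def fun_eq_iff)

lemma delta_conv_delta: "a \<in> carrier G \<Longrightarrow> b \<in> carrier G \<Longrightarrow> delta a \<star> delta b = delta (a \<otimes> b)"
proof
  fix g assume ab: "a \<in> carrier G" "b \<in> carrier G"
  show "(delta a \<star> delta b) g = delta (a \<otimes> b) g"
  proof (cases "g \<in> carrier G")
    case True
    then have "inv a \<otimes> g = b \<longleftrightarrow> g = a \<otimes> b" using ab by (metis inv_solve_left m_closed)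
    then show ?thesis using True ab by (simp add: conv_delta_left) (simp add: delta_def)
  qed (use ab in \<open>auto simp: delta_def\<close>)
qed

lemma supported_delta: "a \<in> K \<Longrightarrow> supported K (delta a)"
  by (auto simp: supported_def delta_def)

text \<open>The inner product becomes a sum of traces in which idempotence allows \<open>p\<close>
  and \<open>f\<close> to be duplicated cyclically. Thus it vanishes only if
  \<open>p \<star> delta k \<star> f = 0\<close> for all \<open>k\<close>, that is, if no non-zero
  homomorphism links the two left ideals.\<close>

lemma cip_cl_cl:
  assumes K: "subgroup K G" and p: "projection K p" and f: "projection K f"
  shows "cip K (cl K p) (cl K f) = of_real (\<Sum>k\<in>K. sqnorm (p \<star> delta k \<star> f))"
proof -
  interpret K: subgroup K G by (rule K)
  have pp: "supported K p" "p \<star> p = p" "star p = p" and ff: "supported K f" "f \<star> f = f" "star f = f"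
    using p f by (auto simp: projection_def)
  have fc: "cnj (f g) = f (inv g)" if "g \<in> carrier G" for g
    using fun_cong[OF ff(3), of "inv g"] that by (simp add: star_def)
  have "cip K (cl K p) (cl K f) = (\<Sum>g\<in>K. p g * cnj (cl K f g))"
    by (rule cip_cl[OF K class_fun_cl[OF K]])
  also have "\<dots> = (\<Sum>g\<in>K. \<Sum>k\<in>K. p g * f (k \<otimes> inv g \<otimes> inv k))"
  proof (intro sum.cong refl)
    fix g assume g: "g \<in> K"
    have "cnj (cl K f g) = (\<Sum>k\<in>K. f (k \<otimes> inv g \<otimes> inv k))"
      using g by (auto simp: cl_def fc inv_mult_group m_assoc intro!: sum.cong)
    then show "p g * cnj (cl K f g) = (\<Sum>k\<in>K. p g * f (k \<otimes> inv g \<otimes> inv k))"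
      by (simp add: sum_distrib_left)
  qed
  also have "\<dots> = (\<Sum>k\<in>K. (p \<star> (delta (inv k) \<star> f \<star> delta k)) \<one>)"
    by (subst sum.swap) (auto simp: conv_one_supported[OF K pp(1)] conv_delta_left conv_delta_right m_assoc
        intro!: sum.cong)
  also have "\<dots> = (\<Sum>k\<in>K. (p \<star> (delta k \<star> f \<star> delta (inv k))) \<one>)"
    by (subst subgroup_sum_inv[OF K, symmetric]) (auto intro!: sum.cong)
  also have "\<dots> = (\<Sum>k\<in>K. of_real (sqnorm (p \<star> delta k \<star> f)))"
  proof (rule sum.cong [OF refl])
    fix k assume k: "k \<in> K"
    let ?a = "p \<star> delta k \<star> f"
    have fz: "f \<star> (f \<star> z) = f \<star> z" for z by (simp only: conv_assoc[symmetric] ff)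
    have "?a \<star> star ?a = p \<star> (delta k \<star> f \<star> delta (inv k) \<star> p)"
      using k by (simp only: star_conv pp ff fz star_delta K.mem_carrier conv_assoc)
    then have "(?a \<star> star ?a) \<one> = (p \<star> (delta k \<star> f \<star> delta (inv k) \<star> p)) \<one>"
      by simp
    also have "\<dots> = (delta k \<star> f \<star> delta (inv k) \<star> p \<star> p) \<one>" by (rule conv_one_commute)
    also have "\<dots> = (delta k \<star> f \<star> delta (inv k) \<star> p) \<one>" by (simp only: conv_assoc pp)
    also have "\<dots> = (p \<star> (delta k \<star> f \<star> delta (inv k))) \<one>" by (rule conv_one_commute)
    finally show "(p \<star> (delta k \<star> f \<star> delta (inv k))) \<one> = of_real (sqnorm ?a)"
      by (simp only: conv_star_one)
  qed
  finally show ?thesis by simp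
qed

lemma sqnorm_scl: "sqnorm (scl c x) = (cmod c)\<^sup>2 * sqnorm x"
  by (simp add: sqnorm_def norm_mult power_mult_distrib sum_distrib_left)

lemma sqnorm_supported:
  assumes "subgroup K G" "supported K x" shows "sqnorm x = (\<Sum>g\<in>K. (cmod (x g))\<^sup>2)"
  using assms subgroup.subset[OF assms(1)] unfolding sqnorm_def
  by (intro sum.mono_neutral_right) (auto simp: supported_def)

lemma primitive_projection: "primitive K f \<Longrightarrow> projection K f"
  by (simp add: primitive_def)

lemma sqnorm_projection_pos:
  assumes "subgroup K G" "projection K p" "p \<noteq> 0" shows "sqnorm p > 0"
  using assms sqnorm_pos[of p] supported_mono[of K p] subgroup.subset[of K G]
  by (auto simp: projection_def)

text \<open>By primitivity \<open>p \<star> delta k \<star> p\<close> is a multiple of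
  \<open>p\<close>; its trace fixes the scalar as \<open>p (inv k) / sqnorm p\<close>, and the
  squared moduli of these sum to \<open>1 / sqnorm p\<close>.\<close>

lemma cip_cl_self:
  assumes K: "subgroup K G" and p: "primitive K p"
  shows "cip K (cl K p) (cl K p) = 1"
proof -
  interpret K: subgroup K G by (rule K)
  have pr: "projection K p" and p0: "p \<noteq> 0" using p by (auto simp: primitive_def)
  then have pp: "supported K p" "p \<star> p = p" "star p = p" by (auto simp: projection_def)
  have pos: "sqnorm p > 0" by (rule sqnorm_projection_pos[OF K pr p0])
  have p1: "p \<one> = of_real (sqnorm p)" using projection_one[OF pr K.subset] .
  have "sqnorm (p \<star> delta k \<star> p) = (cmod (p (inv k)))\<^sup>2 / sqnorm p" if k: "k \<in> K" for k
  proof -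
    obtain c where c: "p \<star> delta k \<star> p = scl c p"
      using p supported_delta[OF k] by (auto simp: primitive_def)
    have "(p \<star> delta k \<star> p) \<one> = (p \<star> (p \<star> delta k)) \<one>" by (rule conv_one_commute)
    also have "\<dots> = (p \<star> delta k) \<one>" by (simp only: conv_assoc[symmetric] pp)
    also have "\<dots> = p (inv k)" using k by (simp add: conv_delta_right)
    finally have "c * of_real (sqnorm p) = p (inv k)" by (simp add: c p1)
    then have "c = p (inv k) / of_real (sqnorm p)" using pos by (simp add: field_simps)
    then show ?thesis using pos
      by (simp add: c sqnorm_scl norm_divide power_divide power2_eq_square)
  qed
  then have "(\<Sum>k\<in>K. sqnorm (p \<star> delta k \<star> p)) = (\<Sum>k\<in>K. (cmod (p (inv k)))\<^sup>2 / sqnorm p)"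
    by simp
  also have "\<dots> = (\<Sum>k\<in>K. (cmod (p k))\<^sup>2) / sqnorm p"
    by (subst subgroup_sum_inv[OF K]) (simp add: sum_divide_distrib)
  also have "\<dots> = 1" using pos sqnorm_supported[OF K pp(1)] by simp
  finally show ?thesis using cip_cl_cl[OF K pr pr] by simp
qed

text \<open>If some \<open>a = p \<star> delta k \<star> f\<close> is non-zero, it is up to scaling
  a partial isometry between \<open>p\<close> and \<open>f\<close>: \<open>a \<star> star a\<close>
  and \<open>star a \<star> a\<close> are multiples of \<open>p\<close> and \<open>f\<close>, and
  they have equal averages.\<close>

lemma cip_cl_orthogonal:
  assumes K: "subgroup K G" and p: "primitive K p" and f: "primitive K f"
  shows "cip K (cl K p) (cl K f) = 0 \<or> cl K p = cl K f"
proof (cases "\<forall>k\<in>K. sqnorm (p \<star> delta k \<star> f) = 0")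
  case True
  then show ?thesis using cip_cl_cl[OF K] p f by (simp add: primitive_def)
next
  case False
  interpret K: subgroup K G by (rule K)
  have pr: "projection K p" and fr: "projection K f" and "p \<noteq> 0" "f \<noteq> 0"
    using p f by (auto simp: primitive_def)
  then have pp: "supported K p" "p \<star> p = p" "star p = p" and ff: "supported K f" "f \<star> f = f" "star f = f"
    by (auto simp: projection_def)
  obtain k where k: "k \<in> K" "sqnorm (p \<star> delta k \<star> f) \<noteq> 0" using False by blast
  define a where "a = p \<star> delta k \<star> f"
  have sa: "supported K a" "supported K (star a)"
    unfolding a_def by (intro supported_star[OF K] supported_conv[OF K] pp ff supported_delta k)+
  have pa: "p \<star> a = a" "star a \<star> p = star a" "a \<star> f = a" "f \<star> star a = star a"
    unfolding a_def by (simp_all only: star_conv conv_assoc pp ff) (simp_all only: conv_assoc[symmetric] pp ff)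
  obtain c where c: "a \<star> star a = scl c p"
    using p supported_conv[OF K sa] unfolding primitive_def by (metis conv_assoc pa(1,2))
  obtain c' where c': "star a \<star> a = scl c' f"
    using f supported_conv[OF K sa(2,1)] unfolding primitive_def by (metis conv_assoc pa(3,4))
  have "(a \<star> star a) \<noteq> 0"
    using conv_star_one(1)[of a] k(2) by (auto simp: a_def)
  then have c0: "c \<noteq> 0" using c by (auto simp: scl_eq_0_iff)
  \<comment> \<open>The two bracketings give \<open>c * c\<close> and \<open>c' * c\<close> as
    coefficients of \<open>p\<close>, so the two scalars agree.\<close>
  have "(a \<star> star a) \<star> (a \<star> star a) = a \<star> (star a \<star> a) \<star> star a" by (simp only: conv_assoc)
  then have "scl (c * c) p = scl (c' * c) p"
    by (simp only: c c' conv_linear pp pa scl_scl)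
  then have "c * c = c' * c" using \<open>p \<noteq> 0\<close> by (rule scl_cancel)
  then have "c = c'" using c0 by simp
  have "scl c (cl K p) = scl c (cl K f)"
    using cl_conv_commute[OF K sa] by (simp only: c c' cl_linear \<open>c = c'\<close>)
  then have "cl K p = cl K f" using c0 by (auto simp: fun_eq_iff)
  then show ?thesis ..
qed

text \<open>Each primitive summand of \<open>p\<close> contributes 0 or 1, so the value is a
  multiplicity. Allowing non-primitive \<open>p\<close> covers induced characters.\<close>

lemma cip_cl_Ints:
  assumes K: "subgroup K G" and p: "projection K p" and f: "primitive K f"
  shows "cip K (cl K p) (cl K f) \<in> \<int>"
proof -
  obtain es where es: "\<forall>e\<in>set es. primitive K e" "p = sum_list es"
    using projection_eq_sum_primitive[OF K p] by blast
  have "cip K (cl K (sum_list es)) (cl K f) \<in> \<int>" using es(1)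
  proof (induction es)
    case Nil
    then show ?case by (simp only: sum_list.Nil cl_linear cip_linear Ints_0)
  next
    case (Cons e es)
    have "cip K (cl K e) (cl K f) \<in> \<int>"
      using cip_cl_orthogonal[OF K _ f, of e] cip_cl_self[OF K f] Cons.prems by auto
    then show ?case using Cons by (simp only: sum_list.Cons cl_linear cip_linear) (simp add: Ints_add)
  qed
  then show ?thesis by (simp add: es)
qed

text \<open>Completeness of the irreducible characters. \<open>star z\<close> is central, so it acts
  on every primitive \<open>f\<close> by a scalar, which orthogonality forces to be 0; summing over
  a decomposition of \<open>delta \<one>\<close> gives \<open>star z = 0\<close>.\<close>

lemma class_fun_eq_0:
  assumes z: "class_fun (carrier G) z"
    and orth: "\<And>f. primitive (carrier G) f \<Longrightarrow> cip (carrier G) (cl (carrier G) f) z = 0"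
  shows "z = 0"
proof -
  let ?G = "carrier G"
  have G: "subgroup ?G G" by (rule subgroup_self)
  have sz: "supported ?G z" using z by (simp add: class_fun_def)
  define u where "u = star z"
  have su: "supported ?G u" unfolding u_def by (rule supported_star[OF G sz])
  have uc: "u (k \<otimes> g) = u (g \<otimes> k)" if "k \<in> ?G" "g \<in> ?G" for k g
  proof -
    have "z (k \<otimes> (inv k \<otimes> inv g) \<otimes> inv k) = z (inv k \<otimes> inv g)"
      using z that by (simp add: class_fun_def)
    then show ?thesis using that by (simp add: u_def star_def inv_mult_group m_assoc[symmetric])
  qed
  have central: "x \<star> u = u \<star> x" for x
  proof
    fix g
    show "(x \<star> u) g = (u \<star> x) g"
    proof (cases "g \<in> ?G")
      case True
      have "(x \<star> u) g = (\<Sum>h\<in>?G. x h * u (g \<otimes> inv h))"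
        using True uc by (simp add: conv_def cong: sum.cong)
      also have "\<dots> = (\<Sum>h\<in>?G. u h * x (inv h \<otimes> g))"
        by (rule sum.reindex_bij_witness[of _ "\<lambda>h. inv h \<otimes> g" "\<lambda>h. g \<otimes> inv h"])
           (use True in \<open>auto simp: inv_mult_group m_assoc\<close>, simp_all add: m_assoc[symmetric])
      finally show ?thesis using True by (simp add: conv_def)
    qed simp
  qed
  have fu: "f \<star> u = 0" if f: "primitive ?G f" for f
  proof -
    have pr: "projection ?G f" "f \<noteq> 0" using f by (auto simp: primitive_def)
    then have ff: "f \<star> f = f" by (simp add: projection_def)
    obtain c where "f \<star> u \<star> f = scl c f" using f su by (auto simp: primitive_def)
    moreover have "f \<star> u \<star> f = f \<star> u" by (simp only: conv_assoc central[symmetric]) (simp only: conv_assoc[symmetric] ff)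
    ultimately have c: "f \<star> u = scl c f" by simp
    have "(f \<star> u) \<one> = (\<Sum>g\<in>?G. f g * cnj (z g))"
      by (simp add: conv_def u_def star_def cong: sum.cong)
    also have "\<dots> = 0" using orth[OF f] cip_cl[OF G z] by simp
    finally have "c * of_real (sqnorm f) = 0" using c projection_one[OF pr(1)] by simp
    then have "c = 0" using sqnorm_projection_pos[OF G pr] by simp
    then show ?thesis by (simp only: c scl_zero)
  qed
  obtain es where es: "\<forall>e\<in>set es. primitive ?G e" "delta \<one> = sum_list es"
    using projection_eq_sum_primitive[OF G projection_delta_one[OF G]] by blast
  have "sum_list es \<star> u = 0" using es(1)
  proof (induction es)
    case (Cons e es)
    have "e \<star> u = 0" by (rule fu) (use Cons.prems in auto)
    moreover have "sum_list es \<star> u = 0" by (rule Cons.IH) (use Cons.prems in auto)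
    ultimately show ?case by (simp only: sum_list.Cons conv_linear add_0)
  qed (simp only: sum_list.Nil conv_zero)
  then have "u = 0" using es(2) conv_delta_one(1)[OF su] by metis
  then have "star u = 0" by (simp only: star_linear)
  then show ?thesis using star_star[OF sz] by (metis u_def)
qed

text \<open>Subtracting from \<open>T\<close> its component of integral coefficient \<open>n \<noteq> 0\<close> leaves squared norm
  \<open>1 - n\<^sup>2 \<ge> 0\<close>.\<close>

lemma norm_one_virtual_character:
  assumes T: "class_fun (carrier G) T" and norm: "cip (carrier G) T T = 1"
    and int: "\<And>f. primitive (carrier G) f \<Longrightarrow> cip (carrier G) T (cl (carrier G) f) \<in> \<int>"
  shows "\<exists>c f. c \<noteq> 0 \<and> primitive (carrier G) f \<and> T = scl c (cl (carrier G) f)"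
proof -
  let ?G = "carrier G"
  have G: "subgroup ?G G" by (rule subgroup_self)
  have "T \<noteq> 0" using norm by (auto simp: cip_def)
  then obtain f where f: "primitive ?G f" "cip ?G (cl ?G f) T \<noteq> 0"
    using class_fun_eq_0[OF T] by blast
  obtain n where n: "cip ?G T (cl ?G f) = of_int n" using int[OF f(1)] by (auto elim: Ints_cases)
  then have n': "cip ?G (cl ?G f) T = of_int n" by (subst cip_commute) simp
  then have "n \<noteq> 0" using f(2) by auto
  define D where "D = T - scl (of_int n) (cl ?G f)"
  have "cip ?G D D = of_real (1 - of_int n * of_int n)"
    unfolding D_def by (simp only: cip_linear n n' norm cip_cl_self[OF G f(1)]) (simp add: algebra_simps)
  then have eq: "(\<Sum>g\<in>?G. (cmod (D g))\<^sup>2) / card ?G = 1 - of_int n * of_int n"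
    unfolding cip_self of_real_eq_iff .
  have "1 \<le> n * n" using \<open>n \<noteq> 0\<close> by (metis mult_eq_0_iff not_less zero_le_square order.order_iff_strict int_one_le_iff_zero_less)
  then have "1 \<le> real_of_int (n * n)" by linarith
  then have "(\<Sum>g\<in>?G. (cmod (D g))\<^sup>2) / card ?G \<le> 0" using eq by simp
  moreover have "card ?G > 0" using finite_subgroup(2)[OF G] .
  ultimately have "(\<Sum>g\<in>?G. (cmod (D g))\<^sup>2) \<le> 0" by (simp add: divide_le_eq)
  then have "(\<Sum>g\<in>?G. (cmod (D g))\<^sup>2) = 0" by (intro antisym sum_nonneg) auto
  then have "\<forall>g\<in>?G. D g = 0" by (simp add: sum_nonneg_eq_0_iff)
  moreover have "D g = 0" if "g \<notin> ?G" for g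
    using T that by (simp add: D_def class_fun_def supported_def cl_def)
  ultimately have "T = scl (of_int n) (cl ?G f)" by (auto simp: D_def fun_eq_iff)
  then show ?thesis using f \<open>n \<noteq> 0\<close> by (intro exI[of _ "of_int n"] exI[of _ f]) simp
qed

section \<open>The Frobenius kernel is a subgroup\<close>

lemma conj_one_cancel:
  assumes "k \<in> carrier G" "h \<in> carrier G" "k \<otimes> h \<otimes> inv k = \<one>" shows "h = \<one>"
  using assms conj_conj[of "inv k" k h] by simp

text \<open>Since the left side is non-negative, this yields both
  \<open>Re (f g) \<le> Re (f \<one>)\<close> and the equality case, in which left translation by
  \<open>g\<close> fixes \<open>f\<close>.\<close>

lemma sqnorm_translate_diff:
  assumes f: "projection (carrier G) f" and g: "g \<in> carrier G"
  shows "sqnorm (delta g \<star> f - f) = 2 * (Re (f \<one>) - Re (f g))"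
proof -
  have ff: "supported (carrier G) f" "f \<star> f = f" "star f = f" using f by (auto simp: projection_def)
  have fg: "cnj (f g) = f (inv g)"
    using fun_cong[OF ff(3), of "inv g"] g by (simp add: star_def)
  have dd: "delta (inv g) \<star> (delta g \<star> z) = delta \<one> \<star> z" for z
    using delta_conv_delta[of "inv g" g] g by (simp add: conv_assoc[symmetric])
  let ?D = "delta g \<star> f - f"
  have "star ?D \<star> ?D = f + f - f \<star> delta (inv g) \<star> f - f \<star> delta g \<star> f"
    using g by (simp only: star_linear star_conv ff star_delta conv_linear conv_assoc dd conv_delta_one)
      (simp only: algebra_simps)
  then have "(star ?D \<star> ?D) \<one> = 2 * f \<one> - (f \<star> delta (inv g) \<star> f) \<one> - (f \<star> delta g \<star> f) \<one>"
    by simp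
  also have "(f \<star> delta (inv g) \<star> f) \<one> = (f \<star> (f \<star> delta (inv g))) \<one>" by (rule conv_one_commute)
  also have "(f \<star> delta g \<star> f) \<one> = (f \<star> (f \<star> delta g)) \<one>" by (rule conv_one_commute)
  finally have "of_real (sqnorm ?D) = 2 * f \<one> - (f \<star> delta (inv g)) \<one> - (f \<star> delta g) \<one>"
    by (simp only: conv_star_one conv_assoc[symmetric] ff)
  then have "of_real (sqnorm ?D) = 2 * f \<one> - f g - cnj (f g)"
    using g by (simp only: conv_delta_right fg inv_closed one_closed l_one inv_inv)
  then show ?thesis using Re_complex_of_real[of "sqnorm ?D"] by (simp only:) simp
qed

lemma projection_one_eq_iff:
  assumes f: "projection (carrier G) f" and g: "g \<in> carrier G"
  shows "f g = f \<one> \<longleftrightarrow> Re (f g) = Re (f \<one>)" "f g = f \<one> \<longleftrightarrow> delta g \<star> f = f"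
proof -
  have sf: "supported (carrier G) f" using f by (simp add: projection_def)
  have "supported (carrier G) (delta g \<star> f - f)" using sf by (auto simp: supported_def)
  then have 1: "delta g \<star> f = f" if "Re (f g) = Re (f \<one>)"
    using that sqnorm_eq_0[of "delta g \<star> f - f"] sqnorm_translate_diff[OF f g] by simp
  have 2: "f g = f \<one>" if "delta g \<star> f = f"
    using that conv_delta_left[OF g g, of f] g by simp
  show "f g = f \<one> \<longleftrightarrow> Re (f g) = Re (f \<one>)" "f g = f \<one> \<longleftrightarrow> delta g \<star> f = f"
    using 1 2 by auto
qed

text \<open>No term of the average has real part above that of \<open>f \<one>\<close>, so the
  average attains its value at \<open>\<one>\<close> only if every term does.\<close>

lemma cl_eq_one_iff:
  assumes f: "projection (carrier G) f" and g: "g \<in> carrier G"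
  shows "cl (carrier G) f g = cl (carrier G) f \<one> \<longleftrightarrow>
     (\<forall>k\<in>carrier G. f (k \<otimes> g \<otimes> inv k) = f \<one>)"
proof
  let ?G = "carrier G"
  have one: "cl ?G f \<one> = (\<Sum>k\<in>?G. f \<one>)" using cl_one[OF subgroup_self] by simp
  { assume "cl ?G f g = cl ?G f \<one>"
    then have "(\<Sum>k\<in>?G. Re (f \<one>) - Re (f (k \<otimes> g \<otimes> inv k))) = 0"
      using g unfolding one by (simp add: cl_def sum_subtractf Re_sum[symmetric] del: Re_sum sum_constant)
    moreover have "0 \<le> Re (f \<one>) - Re (f (k \<otimes> g \<otimes> inv k))" if "k \<in> ?G" for k
      using sqnorm_translate_diff[OF f, of "k \<otimes> g \<otimes> inv k"] sqnorm_nonneg[of "delta (k \<otimes> g \<otimes> inv k) \<star> f - f"]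
        that g by simp
    ultimately have "\<forall>k\<in>?G. Re (f \<one>) - Re (f (k \<otimes> g \<otimes> inv k)) = 0"
      by (subst (asm) sum_nonneg_eq_0_iff) auto
    then show "\<forall>k\<in>?G. f (k \<otimes> g \<otimes> inv k) = f \<one>"
      using projection_one_eq_iff(1)[OF f] g by (metis eq_iff_diff_eq_0 inv_closed m_closed) }
  { assume "\<forall>k\<in>?G. f (k \<otimes> g \<otimes> inv k) = f \<one>"
    then show "cl ?G f g = cl ?G f \<one>" using g unfolding one by (simp add: cl_def) }
qed

text \<open>Membership in the kernel means that all conjugates fix \<open>f\<close> by left
  translation, a condition that passes to products.\<close>

lemma cl_eq_one_mult:
  assumes f: "projection (carrier G) f" and g: "g \<in> carrier G" and h: "h \<in> carrier G"
    and "cl (carrier G) f g = cl (carrier G) f \<one>" "cl (carrier G) f h = cl (carrier G) f \<one>"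
  shows "cl (carrier G) f (g \<otimes> h) = cl (carrier G) f \<one>"
proof -
  have "f (k \<otimes> (g \<otimes> h) \<otimes> inv k) = f \<one>" if k: "k \<in> carrier G" for k
  proof -
    let ?a = "k \<otimes> g \<otimes> inv k" and ?b = "k \<otimes> h \<otimes> inv k"
    have ab: "?a \<in> carrier G" "?b \<in> carrier G" using g h k by auto
    have "f ?a = f \<one>" "f ?b = f \<one>"
      using assms(4,5) cl_eq_one_iff[OF f] g h k by auto
    then have "delta ?a \<star> f = f" "delta ?b \<star> f = f"
      using projection_one_eq_iff(2)[OF f] ab by auto
    then have "delta (?a \<otimes> ?b) \<star> f = f"
      using delta_conv_delta[OF ab] by (metis conv_assoc)
    moreover have "?a \<otimes> ?b = k \<otimes> (g \<otimes> h) \<otimes> inv k"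
      using g h k by (simp add: m_assoc) (simp add: m_assoc[symmetric])
    ultimately show ?thesis using projection_one_eq_iff(2)[OF f] ab by (metis m_closed)
  qed
  then show ?thesis using cl_eq_one_iff[OF f] g h by simp
qed

text \<open>The averaging idempotent of \<open>K\<close>, whose \<open>cl K\<close> is the trivial
  character.\<close>

definition unif where
  "unif K = (\<lambda>g. if g \<in> K then 1 / of_nat (card K) else (0::complex))"

lemma projection_unif:
  assumes K: "subgroup K G" shows "projection K (unif K)"
proof -
  interpret K: subgroup K G by (rule K)
  have s: "supported K (unif K)" by (simp add: supported_def unif_def)
  have "(unif K \<star> unif K) g = unif K g" for g
  proof (cases "g \<in> K")
    case True
    then have "(unif K \<star> unif K) g = (\<Sum>h\<in>K. 1 / of_nat (card K) * (1 / of_nat (card K)))"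
      by (subst conv_eq_sum_subgroup[OF K s]) (auto simp: unif_def intro!: sum.cong)
    then show ?thesis using True finite_subgroup(2)[OF K] by (simp add: unif_def)
  next
    case False
    then show ?thesis using supported_conv[OF K s s] by (simp add: supported_def unif_def)
  qed
  moreover have "inv g \<in> K \<longleftrightarrow> g \<in> K" if "g \<in> carrier G" for g
    using K.m_inv_closed[of g] K.m_inv_closed[of "inv g"] that by auto
  then have "star (unif K) = unif K"
    using K.mem_carrier by (auto simp: star_def unif_def fun_eq_iff)
  ultimately show ?thesis using s by (simp add: projection_def fun_eq_iff)
qed

text \<open>Double counting: every fibre of the map sending \<open>(g, y)\<close> to
  \<open>act g y\<close> has |H| elements, because two translates of \<open>Y\<close> by
  \<open>g\<close> and \<open>g'\<close> meet only if \<open>inv g \<otimes> g'\<close> lies in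
  \<open>H\<close>. It serves both for elements and for tuples of \<open>H\<close>.\<close>

lemma sum_translates:
  fixes act :: "'a \<Rightarrow> 'c \<Rightarrow> 'c" and \<phi> :: "'c \<Rightarrow> 'd :: {comm_semiring_1}"
  assumes H: "subgroup H G" and Y: "finite Y"
    and one: "\<And>y. y \<in> Y \<Longrightarrow> act \<one> y = y"
    and mult: "\<And>a b y. a \<in> carrier G \<Longrightarrow> b \<in> carrier G \<Longrightarrow> y \<in> Y \<Longrightarrow> act a (act b y) = act (a \<otimes> b) y"
    and stab: "\<And>a y. a \<in> carrier G \<Longrightarrow> y \<in> Y \<Longrightarrow> act a y \<in> Y \<longleftrightarrow> a \<in> H"
  shows "(\<Sum>g\<in>carrier G. \<Sum>y\<in>Y. \<phi> (act g y)) =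
      of_nat (card H) * (\<Sum>x\<in>(\<Union>g\<in>carrier G. act g ` Y). \<phi> x)"
proof -
  interpret H: subgroup H G by (rule H)
  let ?P = "carrier G \<times> Y" and ?f = "\<lambda>(g, y). act g y"
  have "(\<Sum>g\<in>carrier G. \<Sum>y\<in>Y. \<phi> (act g y)) = (\<Sum>p\<in>?P. \<phi> (?f p))"
    by (simp add: sum.cartesian_product split_def)
  also have "\<dots> = (\<Sum>x\<in>?f ` ?P. \<Sum>p\<in>{p\<in>?P. ?f p = x}. \<phi> (?f p))"
    by (rule sum.image_gen) (use Y in auto)
  also have "\<dots> = (\<Sum>x\<in>?f ` ?P. of_nat (card H) * \<phi> x)"
  proof (rule sum.cong [OF refl])
    fix x assume "x \<in> ?f ` ?P"
    then obtain g0 y0 where x: "x = act g0 y0" and g0: "g0 \<in> carrier G" and y0: "y0 \<in> Y" by auto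
    \<comment> \<open>From one point \<open>(g0, y0)\<close> of the fibre the others arise by moving
      an element of \<open>H\<close> from the group component to the point.\<close>
    have "bij_betw (\<lambda>h. (g0 \<otimes> inv h, act h y0)) H {p\<in>?P. ?f p = x}"
    proof (rule bij_betwI')
      fix h h' assume h: "h \<in> H" "h' \<in> H"
      have "h = h'" if "g0 \<otimes> inv h = g0 \<otimes> inv h'"
      proof -
        have "inv g0 \<otimes> (g0 \<otimes> inv h) = inv g0 \<otimes> (g0 \<otimes> inv h')" using that by simp
        then have "inv h = inv h'" using g0 h by (simp add: m_assoc[symmetric])
        then show ?thesis using h by (metis H.mem_carrier inv_inv)
      qed
      then show "((g0 \<otimes> inv h, act h y0) = (g0 \<otimes> inv h', act h' y0)) = (h = h')" by auto
    next
      fix h assume h: "h \<in> H"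
      then show "(g0 \<otimes> inv h, act h y0) \<in> {p\<in>?P. ?f p = x}"
        using g0 y0 stab[of h y0] mult[of "g0 \<otimes> inv h" h y0] by (simp add: x) (simp add: m_assoc)
    next
      fix p assume p: "p \<in> {p\<in>?P. ?f p = x}"
      then obtain g y where gy: "p = (g, y)" "g \<in> carrier G" "y \<in> Y" "act g y = act g0 y0"
        by (auto simp: x)
      have e: "act (inv g \<otimes> g0) y0 = y"
        using mult[of "inv g" g0 y0] mult[of "inv g" g y] one[of y] gy g0 y0 by simp
      then have "inv g \<otimes> g0 \<in> H" using stab[of "inv g \<otimes> g0" y0] gy g0 y0 by simp
      moreover have g: "g0 \<otimes> inv (inv g \<otimes> g0) = g" using gy(2) g0 by (simp add: inv_mult_group m_assoc[symmetric])
      ultimately show "\<exists>h\<in>H. p = (g0 \<otimes> inv h, act h y0)"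
        by (intro bexI[of _ "inv g \<otimes> g0"]) (simp_all only: g e gy(1))
    qed
    then have "card {p\<in>?P. ?f p = x} = card H" by (rule bij_betw_same_card[symmetric])
    moreover have "(\<Sum>p\<in>{p\<in>?P. ?f p = x}. \<phi> (?f p)) = (\<Sum>p\<in>{p\<in>?P. ?f p = x}. \<phi> x)"
      by (rule sum.cong) auto
    ultimately show "(\<Sum>p\<in>{p\<in>?P. ?f p = x}. \<phi> (?f p)) = of_nat (card H) * \<phi> x"
      by (simp del: split_paired_All)
  qed
  also have "?f ` ?P = (\<Union>g\<in>carrier G. act g ` Y)" by auto
  finally show ?thesis by (simp add: sum_distrib_left)
qed

end

section \<open>Frobenius groups and the extension of characters from the complement\<close>

locale frobenius_group = finite_group +
  fixes H N :: "'a set"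
  assumes complement: "frobenius_complement G H" and N_def: "N = frobenius_kernel G H"
begin

lemma subgroup_H: "subgroup H G"
  using complement by (simp add: frobenius_complement_def)

sublocale H: subgroup H G by (rule subgroup_H)

lemma conj_in_H:
  assumes "g \<in> carrier G" "h \<in> H" "h \<noteq> \<one>" shows "g \<otimes> h \<otimes> inv g \<in> H \<longleftrightarrow> g \<in> H"
proof
  assume *: "g \<otimes> h \<otimes> inv g \<in> H"
  show "g \<in> H"
  proof (rule ccontr)
    assume "g \<notin> H"
    then have "H \<inter> conj_set G g H = {\<one>}"
      using complement assms(1) by (simp add: frobenius_complement_def)
    then have "g \<otimes> h \<otimes> inv g = \<one>" using * assms(2) by (auto simp: conj_set_def)
    then show False using conj_one_cancel assms by auto
  qed
qed (use assms in auto)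

lemma N_subset: "N \<subseteq> carrier G" "\<one> \<in> N"
  by (auto simp: N_def frobenius_kernel_def)

lemma not_N: "carrier G - N = (\<Union>g\<in>carrier G. (\<lambda>h. g \<otimes> h \<otimes> inv g) ` (H - {\<one>}))"
proof (intro equalityI subsetI)
  fix x assume x: "x \<in> carrier G - N"
  then obtain g h where gh: "g \<in> carrier G" "h \<in> H" "x = g \<otimes> h \<otimes> inv g"
    by (auto simp: N_def frobenius_kernel_def conj_set_def)
  moreover from this have "h \<noteq> \<one>" using x N_subset by auto
  ultimately show "x \<in> (\<Union>g\<in>carrier G. (\<lambda>h. g \<otimes> h \<otimes> inv g) ` (H - {\<one>}))" by blast
next
  fix x assume "x \<in> (\<Union>g\<in>carrier G. (\<lambda>h. g \<otimes> h \<otimes> inv g) ` (H - {\<one>}))"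
  then obtain g h where gh: "g \<in> carrier G" "h \<in> H" "h \<noteq> \<one>" "x = g \<otimes> h \<otimes> inv g" by blast
  then have "x \<noteq> \<one>" using conj_one_cancel[of g h] by auto
  moreover have "x \<in> conj_set G g H" using gh by (simp add: conj_set_def)
  ultimately show "x \<in> carrier G - N" using gh by (auto simp: N_def frobenius_kernel_def)
qed

lemma sum_not_N:
  fixes \<phi> :: "'a \<Rightarrow> 'd :: {comm_semiring_1}"
  shows "of_nat (card H) * (\<Sum>x\<in>carrier G - N. \<phi> x) =
    (\<Sum>g\<in>carrier G. \<Sum>h\<in>H - {\<one>}. \<phi> (g \<otimes> h \<otimes> inv g))"
  unfolding not_N
proof (rule sum_translates[OF subgroup_H, symmetric])
  fix a h assume a: "a \<in> carrier G" and "h \<in> H - {\<one>}"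
  then have h: "h \<in> H" "h \<noteq> \<one>" by auto
  have "a \<otimes> h \<otimes> inv a \<noteq> \<one>" using conj_one_cancel[OF a _ ] h by auto
  then show "a \<otimes> h \<otimes> inv a \<in> H - {\<one>} \<longleftrightarrow> a \<in> H" using conj_in_H[OF a h] by simp
qed (use finite_subgroup(1)[OF subgroup_H] in \<open>simp_all add: conj_conj\<close>)

lemma card_N_H: "card N * card H = card (carrier G)"
proof -
  have "card H * (card (carrier G) - card N) = card (carrier G) * (card H - 1)"
    using sum_not_N[of "\<lambda>_. 1::nat"] N_subset finite_subset[OF _ fin]
      finite_subgroup(1)[OF subgroup_H] by (simp add: card_Diff_subset)
  moreover have "card N \<le> card (carrier G)" using N_subset by (simp add: card_mono)
  then obtain r where "card (carrier G) = card N + r" by (auto simp: le_iff_add)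
  moreover obtain m where "card H = Suc m" using finite_subgroup(2)[OF subgroup_H] gr0_conv_Suc by auto
  ultimately show ?thesis by (simp add: algebra_simps)
qed

text \<open>\<open>cl (carrier G) (virt e)\<close> is the character of \<open>H\<close> given by \<open>e\<close>, of degree \<open>d = cl H e \<one>\<close>, minus
  \<open>d\<close> times the trivial character, induced to \<open>G\<close>, plus \<open>d\<close> times the trivial character. It extends
  \<open>cl H e\<close>, is constant on \<open>N\<close> and has norm one.\<close>

definition virt where
  "virt e = e - scl (cl H e \<one>) (unif H) + scl (cl H e \<one>) (unif (carrier G))"

text \<open>Only \<open>k\<close> in \<open>H\<close> contribute to the average, as any other
  conjugation moves \<open>h\<close> out of \<open>H\<close>.\<close>

lemma cl_G_H:
  assumes x: "supported H x" and h: "h \<in> H" "h \<noteq> \<one>" shows "cl (carrier G) x h = cl H x h"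
  using h conj_in_H[OF _ h] x H.subset unfolding cl_def
  by (auto simp: supported_def intro!: sum.mono_neutral_right)

lemma cl_G_N:
  assumes x: "supported H x" and g: "g \<in> N" "g \<noteq> \<one>" shows "cl (carrier G) x g = 0"
proof -
  have gc: "g \<in> carrier G" using g N_subset by auto
  have "k \<otimes> g \<otimes> inv k \<notin> H" if k: "k \<in> carrier G" for k
  proof
    assume *: "k \<otimes> g \<otimes> inv k \<in> H"
    have "g = inv k \<otimes> (k \<otimes> g \<otimes> inv k) \<otimes> inv (inv k)" using conj_conj[of "inv k" k g] k gc by simp
    then have "g \<in> conj_set G (inv k) H" using * unfolding conj_set_def by blast
    then show False using g k by (auto simp: N_def frobenius_kernel_def)
  qed
  then show ?thesis using x by (simp add: cl_def supported_def)
qed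

lemma cl_unif:
  assumes "subgroup K G" "g \<in> K" shows "cl K (unif K) g = 1"
proof -
  interpret K: subgroup K G by (rule assms)
  show ?thesis using assms finite_subgroup(2)[OF assms(1)] by (simp add: cl_def unif_def)
qed

text \<open>Both induced terms have the value |G : H| d at \<open>\<one>\<close> and cancel; the
  trivial character added at the end restores the degree d.\<close>

lemma cl_virt_one:
  "cl (carrier G) (virt e) \<one> = cl H e \<one>"
proof -
  have "of_nat (card (carrier G)) * e \<one> = of_nat (card (carrier G)) * (cl H e \<one> / of_nat (card H))"
    using finite_subgroup(2)[OF subgroup_H] by (simp add: cl_one[OF subgroup_H])
  moreover have "of_nat (card (carrier G)) \<noteq> (0::complex)"
    using finite_subgroup(2)[OF subgroup_self] by (metis of_nat_eq_0_iff less_irrefl)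
  ultimately show ?thesis
    by (simp add: cl_one[OF subgroup_self] virt_def unif_def algebra_simps)
qed

lemma cl_virt_H:
  assumes e: "supported H e" and h: "h \<in> H" shows "cl (carrier G) (virt e) h = cl H e h"
proof (cases "h = \<one>")
  case False
  have "supported H (unif H)" by (simp add: supported_def unif_def)
  then show ?thesis using h False unfolding virt_def
    by (simp add: cl_linear cl_G_H[OF e h] cl_G_H cl_unif[OF subgroup_H] cl_unif[OF subgroup_self])
qed (simp add: cl_virt_one)

lemma cl_virt_N:
  assumes e: "supported H e" and g: "g \<in> N" shows "cl (carrier G) (virt e) g = cl H e \<one>"
proof (cases "g = \<one>")
  case False
  have "supported H (unif H)" by (simp add: supported_def unif_def)
  then show ?thesis using g False N_subset unfolding virt_def
    by (auto simp: cl_linear cl_G_N[OF e g] cl_G_N cl_unif[OF subgroup_self])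
qed (simp add: cl_virt_one)

text \<open>With d the degree, the elements outside \<open>N\<close> contribute |G : H| (|H| - d^2)
  to the sum of squares, and \<open>N\<close> contributes |N| d^2. As |N| = |G : H|, the total is
  |G|.\<close>

lemma cip_cl_virt:
  assumes e: "primitive H e" shows "cip (carrier G) (cl (carrier G) (virt e)) (cl (carrier G) (virt e)) = 1"
proof -
  let ?T = "cl (carrier G) (virt e)" and ?G = "carrier G"
  define d where "d = cl H e \<one>"
  have se: "supported H e" using e by (simp add: primitive_def projection_def)
  have fH: "finite H" "card H > 0" using finite_subgroup[OF subgroup_H] by auto
  have cG: "card ?G > 0" using finite_subgroup(2)[OF subgroup_self] .
  have "of_real ((\<Sum>g\<in>H. (cmod (cl H e g))\<^sup>2) / card H) = complex_of_real 1"
    using cip_cl_self[OF subgroup_H e] cip_self[of H "cl H e"] by simp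
  then have "(\<Sum>g\<in>H. (cmod (cl H e g))\<^sup>2) = card H"
    unfolding of_real_eq_iff using fH by (simp add: field_simps)
  then have sH: "(\<Sum>g\<in>H - {\<one>}. (cmod (cl H e g))\<^sup>2) = card H - (cmod d)\<^sup>2"
    using fH by (simp add: sum_diff1 d_def)
  have cT: "class_fun ?G ?T" by (rule class_fun_cl[OF subgroup_self])
  have "card H * (\<Sum>g\<in>?G - N. (cmod (?T g))\<^sup>2) = (\<Sum>g\<in>?G. \<Sum>h\<in>H - {\<one>}. (cmod (?T (g \<otimes> h \<otimes> inv g)))\<^sup>2)"
    by (rule sum_not_N)
  also have "\<dots> = (\<Sum>g\<in>?G. \<Sum>h\<in>H - {\<one>}. (cmod (cl H e h))\<^sup>2)"
    using cT by (intro sum.cong refl) (simp add: class_fun_def cl_virt_H[OF se])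
  also have "\<dots> = card ?G * (card H - (cmod d)\<^sup>2)" by (simp add: sH)
  finally have 1: "card H * (\<Sum>g\<in>?G - N. (cmod (?T g))\<^sup>2) = card ?G * (card H - (cmod d)\<^sup>2)" .
  have "(\<Sum>g\<in>N. (cmod (?T g))\<^sup>2) = card N * (cmod d)\<^sup>2" by (simp add: cl_virt_N[OF se] d_def)
  then have 2: "card H * (\<Sum>g\<in>N. (cmod (?T g))\<^sup>2) = card ?G * (cmod d)\<^sup>2"
    using card_N_H by (metis mult.assoc mult.commute of_nat_mult)
  have "(\<Sum>g\<in>?G. (cmod (?T g))\<^sup>2) = (\<Sum>g\<in>?G - N. (cmod (?T g))\<^sup>2) + (\<Sum>g\<in>N. (cmod (?T g))\<^sup>2)"
    by (rule sum.subset_diff) (use N_subset in auto)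
  then have "card H * (\<Sum>g\<in>?G. (cmod (?T g))\<^sup>2) = card H * real (card ?G)"
    using 1 2 by (simp add: algebra_simps)
  moreover have "real (card H) \<noteq> 0" using fH(2) by linarith
  ultimately have "(\<Sum>g\<in>?G. (cmod (?T g))\<^sup>2) = card ?G" by (simp only: mult_cancel_left) simp
  then show ?thesis unfolding cip_self using cG by (metis divide_self less_irrefl of_nat_eq_0_iff of_real_1)
qed

lemma cip_cl_virt_Ints:
  assumes e: "primitive H e" and f: "primitive (carrier G) f"
  shows "cip (carrier G) (cl (carrier G) (virt e)) (cl (carrier G) f) \<in> \<int>"
proof -
  \<comment> \<open>\<open>cl H (delta \<one>)\<close> is the regular character, so the degree of
    \<open>e\<close> is a multiplicity and hence an integer.\<close>
  have "cip H (cl H (delta \<one>)) (cl H e) = cnj (cl H e \<one>)"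
    using finite_subgroup(1)[OF subgroup_H]
    by (simp add: cip_cl[OF subgroup_H class_fun_cl[OF subgroup_H]] delta_def
        if_distrib[of "\<lambda>u. u * _"] sum.delta cong: if_cong)
  then have "cnj (cl H e \<one>) \<in> \<int>"
    using cip_cl_Ints[OF subgroup_H projection_delta_one[OF subgroup_H] e] by simp
  then have d: "cl H e \<one> \<in> \<int>" by (metis Ints_cases Ints_of_int complex_cnj_cnj complex_cnj_of_int)
  \<comment> \<open>A projection of the smaller algebra stays one in the larger, although
    primitivity may be lost. Hence \<open>virt e\<close> is an integral combination of projections
    for \<open>G\<close>.\<close>
  have pr: "projection (carrier G) p" if "projection H p" for p
    using that supported_mono[OF _ H.subset] by (simp add: projection_def)
  show ?thesis
    unfolding virt_def cl_linear cip_linear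
    by (intro Ints_add Ints_diff Ints_mult d cip_cl_Ints[OF subgroup_self _ f] pr
        projection_unif subgroup_H subgroup_self primitive_projection e)
qed

text \<open>An element outside \<open>N\<close> is conjugate to some
  \<open>h \<noteq> \<one>\<close> in \<open>H\<close>. If all extended characters failed to
  separate it from \<open>\<one>\<close>, so would their sum over a decomposition of
  \<open>delta \<one>\<close>, the regular character of \<open>H\<close>, which is 0 at
  \<open>h\<close> and |H| at \<open>\<one>\<close>.\<close>

lemma N_eq: "N = {g \<in> carrier G. \<forall>e. primitive H e \<longrightarrow>
    cl (carrier G) (virt e) g = cl (carrier G) (virt e) \<one>}"
proof (intro equalityI subsetI CollectI conjI allI impI)
  fix g e assume "g \<in> N" "primitive H e"
  then show "cl (carrier G) (virt e) g = cl (carrier G) (virt e) \<one>"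
    using cl_virt_N cl_virt_one by (simp add: primitive_def projection_def)
next
  fix g assume g: "g \<in> {g \<in> carrier G. \<forall>e. primitive H e \<longrightarrow>
    cl (carrier G) (virt e) g = cl (carrier G) (virt e) \<one>}"
  show "g \<in> N"
  proof (rule ccontr)
    assume "g \<notin> N"
    then have "g \<in> carrier G - N" using g by simp
    then obtain k h where k: "k \<in> carrier G" and h: "h \<in> H" "h \<noteq> \<one>" and gkh: "g = k \<otimes> h \<otimes> inv k"
      unfolding not_N by auto
    have eq: "cl H e h = cl H e \<one>" if e: "primitive H e" for e
    proof -
      have se: "supported H e" using e by (simp add: primitive_def projection_def)
      have "cl (carrier G) (virt e) g = cl (carrier G) (virt e) h"
        using class_fun_cl[OF subgroup_self, of "virt e"] k h by (simp add: class_fun_def gkh)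
      then show ?thesis using g e cl_virt_H[OF se] h by simp
    qed
    obtain es where es: "\<forall>e\<in>set es. primitive H e" "delta \<one> = sum_list es"
      using projection_eq_sum_primitive[OF subgroup_H projection_delta_one[OF subgroup_H]] by blast
    have "cl H (sum_list es) h = cl H (sum_list es) \<one>" using es(1)
    proof (induction es)
      case Nil
      show ?case by (simp add: cl_def)
    next
      case (Cons e es)
      then show ?case by (simp only: sum_list.Cons cl_linear) (simp add: eq)
    qed
    then have "cl H (delta \<one>) h = cl H (delta \<one>) \<one>" by (simp only: es(2)[symmetric])
    moreover have "delta \<one> (k \<otimes> h \<otimes> inv k) = 0" if "k \<in> H" for k
      using conj_one_cancel[of k h] h that by (auto simp: delta_def)
    then have "cl H (delta \<one>) h = 0" by (simp add: cl_def)
    moreover have "cl H (delta \<one>) \<one> = of_nat (card H)" by (simp add: cl_one[OF subgroup_H] delta_def)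
    ultimately show False using finite_subgroup(2)[OF subgroup_H] by simp
  qed
qed (use N_subset in auto)

lemma subgroup_N: "subgroup N G"
proof -
  have mult: "a \<otimes> b \<in> N" if a: "a \<in> N" and b: "b \<in> N" for a b
  proof -
    have ab: "a \<in> carrier G" "b \<in> carrier G" using a b N_subset by auto
    have "cl (carrier G) (virt e) (a \<otimes> b) = cl (carrier G) (virt e) \<one>" if e: "primitive H e" for e
    proof -
      let ?T = "cl (carrier G) (virt e)"
      obtain c f where cf: "c \<noteq> 0" "primitive (carrier G) f" "?T = scl c (cl (carrier G) f)"
        using norm_one_virtual_character[OF class_fun_cl[OF subgroup_self] cip_cl_virt[OF e] cip_cl_virt_Ints[OF e]]
        by blast
      have "?T a = ?T \<one>" "?T b = ?T \<one>" using a b e N_eq by auto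
      \<comment> \<open>The non-zero factor \<open>c\<close> cancels, so the condition on
        \<open>?T\<close> is the kernel condition for the irreducible \<open>f\<close>.\<close>
      then show ?thesis using cl_eq_one_mult[OF primitive_projection[OF cf(2)] ab] cf(1) by (simp add: cf(3))
    qed
    then show ?thesis using ab by (subst N_eq) simp
  qed
  \<comment> \<open>The complement of \<open>N\<close> is closed under inverses because
    \<open>H\<close> is, hence so is \<open>N\<close>.\<close>
  have "inv a \<in> N" if a: "a \<in> N" for a
  proof (rule ccontr)
    assume "inv a \<notin> N"
    then have "inv a \<in> carrier G - N" using a N_subset by auto
    then obtain k h where k: "k \<in> carrier G" and h: "h \<in> H" "h \<noteq> \<one>" and e: "inv a = k \<otimes> h \<otimes> inv k"
      unfolding not_N by auto
    have "a = inv (inv a)" using a N_subset by auto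
    also have "\<dots> = k \<otimes> inv h \<otimes> inv k" unfolding e using k h by (simp add: inv_mult_group m_assoc)
    finally have "a = k \<otimes> inv h \<otimes> inv k" .
    moreover have "inv h \<in> H - {\<one>}" using h by auto
    ultimately have "a \<in> carrier G - N" unfolding not_N using k by blast
    then show False using a by simp
  qed
  then show ?thesis using mult N_subset by unfold_locales auto
qed

end

section \<open>Counting commuting tuples\<close>

lemma commuting_tuples_iff:
  "xs \<in> commuting_tuples G n \<longleftrightarrow> length xs = n \<and> set xs \<subseteq> carrier G \<and>
     (\<forall>x\<in>set xs. \<forall>y\<in>set xs. x \<otimes>\<^bsub>G\<^esub> y = y \<otimes>\<^bsub>G\<^esub> x)"
  by (auto simp: commuting_tuples_def all_set_conv_all_nth)

context finite_group
begin

definition conj_list where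
  "conj_list g xs = map (\<lambda>x. g \<otimes> x \<otimes> inv g) xs"

lemma conj_list_mult:
  "a \<in> carrier G \<Longrightarrow> b \<in> carrier G \<Longrightarrow> xs \<in> commuting_tuples G n \<Longrightarrow>
     conj_list a (conj_list b xs) = conj_list (a \<otimes> b) xs"
  by (auto simp: conj_list_def commuting_tuples_iff conj_conj)

lemma conj_list_one: "xs \<in> commuting_tuples G n \<Longrightarrow> conj_list \<one> xs = xs"
  by (auto simp: conj_list_def commuting_tuples_iff intro!: map_idI)

lemma conj_mult_distrib:
  assumes "g \<in> carrier G" "x \<in> carrier G" "y \<in> carrier G"
  shows "(g \<otimes> x \<otimes> inv g) \<otimes> (g \<otimes> y \<otimes> inv g) = g \<otimes> (x \<otimes> y) \<otimes> inv g"
proof -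
  have "(g \<otimes> x \<otimes> inv g) \<otimes> (g \<otimes> y \<otimes> inv g) = g \<otimes> x \<otimes> (inv g \<otimes> g) \<otimes> y \<otimes> inv g"
    using assms by (simp only: m_assoc m_closed inv_closed)
  also have "\<dots> = g \<otimes> (x \<otimes> y) \<otimes> inv g" using assms by (simp add: m_assoc)
  finally show ?thesis .
qed

lemma conj_list_closed:
  assumes "g \<in> carrier G" "xs \<in> commuting_tuples G n"
  shows "conj_list g xs \<in> commuting_tuples G n"
  using assms conj_mult_distrib by (auto simp: conj_list_def commuting_tuples_iff subset_iff)

lemma finite_commuting_tuples: "finite (commuting_tuples G n)"
  by (rule finite_subset[OF _ finite_lists_length_eq[OF fin, of n]]) (auto simp: commuting_tuples_def)

lemma group_action_conj_list:
  "group_action G (commuting_tuples G n) (\<lambda>g. \<lambda>xs\<in>commuting_tuples G n. conj_list g xs)"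
proof -
  let ?E = "commuting_tuples G n"
  let ?f = "\<lambda>g. \<lambda>xs\<in>?E. conj_list g xs"
  have Bij: "?f g \<in> Bij ?E" if g: "g \<in> carrier G" for g
  proof -
    have "bij_betw (?f g) ?E ?E"
      by (rule bij_betwI[where g = "conj_list (inv g)"])
         (use g in \<open>auto simp: conj_list_closed conj_list_mult conj_list_one\<close>)
    then show ?thesis by (simp add: Bij_def)
  qed
  have "?f (a \<otimes> b) = compose ?E (?f a) (?f b)" if "a \<in> carrier G" "b \<in> carrier G" for a b
    using that by (auto simp: compose_def fun_eq_iff conj_list_closed conj_list_mult)
  then have "?f \<in> hom G (BijGroup ?E)" using Bij by (auto simp: hom_def BijGroup_def)
  then show ?thesis
    by (auto simp: group_action_def group_hom_def group_hom_axioms_def group_BijGroup is_group)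
qed

lemma conj_eq_iff_commute:
  assumes "g \<in> carrier G" "x \<in> carrier G" shows "g \<otimes> x \<otimes> inv g = x \<longleftrightarrow> g \<otimes> x = x \<otimes> g"
  using assms by (metis inv_closed inv_solve_right m_closed)

text \<open>Turns the pairs counted by Burnside's lemma, a group element with a tuple that it fixes,
  into commuting tuples longer by one.\<close>

lemma Cons_commuting_tuples_iff:
  "g # xs \<in> commuting_tuples G (Suc n) \<longleftrightarrow>
     g \<in> carrier G \<and> xs \<in> commuting_tuples G n \<and> conj_list g xs = xs"
proof -
  have "conj_list g xs = xs \<longleftrightarrow> (\<forall>x\<in>set xs. g \<otimes> x \<otimes> inv g = x)"
    unfolding conj_list_def by (induction xs) auto
  then show ?thesis
    using conj_eq_iff_commute by (auto simp: commuting_tuples_iff subset_iff)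
qed

lemma beta_mult_card:
  "beta G n * card (carrier G) = card (commuting_tuples G (Suc n))"
proof -
  let ?E = "commuting_tuples G n"
  let ?f = "\<lambda>g. \<lambda>xs\<in>?E. conj_list g xs"
  interpret group_action G ?E ?f by (rule group_action_conj_list)
  have orbit: "sim_conj_rel G n `` {xs} = orbit G ?f xs" if "xs \<in> ?E" for xs
    using that conj_list_closed by (auto simp: sim_conj_rel_def orbit_def conj_list_def[symmetric])
  then have "?E // sim_conj_rel G n = orbits G ?E ?f"
    by (auto simp: quotient_def orbits_def)
  then have "beta G n * card (carrier G) = (\<Sum>g\<in>carrier G. card (invariants ?E ?f g))"
    using burnside[OF fin finite_commuting_tuples] by (simp add: beta_def Coset.order_def)
  also have "\<dots> = card (SIGMA g:carrier G. invariants ?E ?f g)"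
    using finite_commuting_tuples by (subst card_SigmaI) (simp_all add: invariants_def)
  also have "\<dots> = card (commuting_tuples G (Suc n))"
  proof (rule bij_betw_same_card[of "\<lambda>(g, xs). g # xs"], rule bij_betwI')
    fix ys assume ys: "ys \<in> commuting_tuples G (Suc n)"
    then obtain g xs where "ys = g # xs" by (cases ys) (auto simp: commuting_tuples_def)
    then show "\<exists>p\<in>SIGMA g:carrier G. invariants ?E ?f g. ys = (case p of (g, xs) \<Rightarrow> g # xs)"
      using ys by (intro bexI[of _ "(g, xs)"]) (auto simp: invariants_def Cons_commuting_tuples_iff)
  qed (auto simp: invariants_def Cons_commuting_tuples_iff)
  finally show ?thesis .
qed

end

lemma (in finite_group) finite_group_subgroup:
  assumes "subgroup K G" shows "finite_group (G\<lparr>carrier := K\<rparr>)"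
  using subgroup.subgroup_is_group[OF assms is_group] finite_subgroup(1)[OF assms]
  by (simp add: finite_group_def finite_group_axioms_def)

lemma commuting_tuples_carrier:
  "K \<subseteq> carrier G \<Longrightarrow> commuting_tuples (G\<lparr>carrier := K\<rparr>) n = {xs \<in> commuting_tuples G n. set xs \<subseteq> K}"
  by (auto simp: commuting_tuples_iff subset_iff)

section \<open>Commuting tuples of a Frobenius group\<close>

context frobenius_group
begin

text \<open>One entry outside \<open>N\<close> decides: conjugate it to some
  \<open>h \<noteq> \<one>\<close> in \<open>H\<close>; all other entries then commute with
  \<open>h\<close> and therefore lie in \<open>H\<close>. The trivial tuple is removed from
  \<open>H\<close> since it already counts for \<open>N\<close>.\<close>

lemma commuting_tuples_eq_Un:
  "commuting_tuples G n = commuting_tuples (G\<lparr>carrier := N\<rparr>) n \<union>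
     (\<Union>g\<in>carrier G. conj_list g ` (commuting_tuples (G\<lparr>carrier := H\<rparr>) n - {replicate n \<one>}))"
    (is "?G = ?N \<union> ?Z")
  and commuting_tuples_disjoint:
  "commuting_tuples (G\<lparr>carrier := N\<rparr>) n \<inter>
     (\<Union>g\<in>carrier G. conj_list g ` (commuting_tuples (G\<lparr>carrier := H\<rparr>) n - {replicate n \<one>})) = {}"
proof -
  have nontriv: "\<exists>h\<in>set ys. h \<in> H \<and> h \<noteq> \<one>"
    if "ys \<in> commuting_tuples (G\<lparr>carrier := H\<rparr>) n - {replicate n \<one>}" for ys
    using that by (auto simp: commuting_tuples_iff subset_iff) (metis replicate_eqI)
  have "xs \<in> ?Z" if xs: "xs \<in> ?G" "xs \<notin> ?N" for xs
  proof -
    obtain x where x: "x \<in> set xs" "x \<in> carrier G - N"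
      using xs by (auto simp: commuting_tuples_carrier[OF N_subset(1)] commuting_tuples_iff)
    then obtain g h where g: "g \<in> carrier G" and h: "h \<in> H" "h \<noteq> \<one>" and xg: "x = g \<otimes> h \<otimes> inv g"
      unfolding not_N by auto
    define ys where "ys = conj_list (inv g) xs"
    have ys: "ys \<in> ?G" unfolding ys_def using conj_list_closed g xs by simp
    have "h = inv g \<otimes> x \<otimes> inv (inv g)" using conj_conj[of "inv g" g h] g h by (simp add: xg)
    then have hys: "h \<in> set ys" using x unfolding ys_def conj_list_def by auto
    have "y \<in> H" if y: "y \<in> set ys" for y
    proof -
      have yc: "y \<in> carrier G" "y \<otimes> h = h \<otimes> y" using ys y hys by (auto simp: commuting_tuples_iff)
      then have "y \<otimes> h \<otimes> inv y = h" using conj_eq_iff_commute[OF yc(1) H.mem_carrier[OF h(1)]] by blast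
      then show ?thesis using conj_in_H[OF yc(1) h] h by simp
    qed
    then have "ys \<in> commuting_tuples (G\<lparr>carrier := H\<rparr>) n"
      using ys by (auto simp: commuting_tuples_carrier[OF H.subset])
    moreover have "ys \<noteq> replicate n \<one>" using hys h by auto
    moreover have "xs = conj_list g ys"
      using conj_list_mult[of g "inv g" xs n] conj_list_one xs g by (simp add: ys_def)
    ultimately show ?thesis using g by blast
  qed
  moreover have "?Z \<subseteq> ?G"
    using conj_list_closed by (auto simp: commuting_tuples_carrier[OF H.subset])
  moreover have "?N \<subseteq> ?G" by (auto simp: commuting_tuples_carrier[OF N_subset(1)])
  ultimately show "?G = ?N \<union> ?Z" by blast
  have "conj_list g ys \<notin> ?N"
    if g: "g \<in> carrier G" and ys: "ys \<in> commuting_tuples (G\<lparr>carrier := H\<rparr>) n - {replicate n \<one>}" for g ys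
  proof -
    obtain h where h: "h \<in> set ys" "h \<in> H" "h \<noteq> \<one>" using nontriv[OF ys] by blast
    then have "g \<otimes> h \<otimes> inv g \<in> carrier G - N" unfolding not_N using g by blast
    moreover have "g \<otimes> h \<otimes> inv g \<in> set (conj_list g ys)" using h by (auto simp: conj_list_def)
    ultimately show ?thesis by (auto simp: commuting_tuples_iff)
  qed
  then show "?N \<inter> ?Z = {}" by blast
qed

lemma card_commuting_tuples:
  "card H * card (commuting_tuples G n) = card H * card (commuting_tuples (G\<lparr>carrier := N\<rparr>) n) +
     card (carrier G) * (card (commuting_tuples (G\<lparr>carrier := H\<rparr>) n) - 1)"
proof -
  let ?Y = "commuting_tuples (G\<lparr>carrier := H\<rparr>) n - {replicate n \<one>}"
  let ?Z = "\<Union>g\<in>carrier G. conj_list g ` ?Y"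
  have YG: "?Y \<subseteq> commuting_tuples G n" by (auto simp: commuting_tuples_carrier[OF H.subset])
  have fY: "finite ?Y" by (rule finite_subset[OF YG finite_commuting_tuples])
  have "(\<Sum>g\<in>carrier G. \<Sum>y\<in>?Y. 1) = of_nat (card H) * (\<Sum>x\<in>?Z. 1::nat)"
  proof (rule sum_translates[OF subgroup_H fY])
    fix a ys assume a: "a \<in> carrier G" and ys: "ys \<in> ?Y"
    then have "ys \<noteq> replicate n \<one>" "length ys = n" "set ys \<subseteq> H" by (auto simp: commuting_tuples_iff)
    \<comment> \<open>A single non-trivial entry controls the whole tuple: if its conjugate by
      \<open>a\<close> stays in \<open>H\<close>, then \<open>a\<close> is in
      \<open>H\<close>.\<close>
    then obtain h where h: "h \<in> set ys" "h \<in> H" "h \<noteq> \<one>" by (metis replicate_eqI subset_iff)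
    have mem: "a \<otimes> h \<otimes> inv a \<in> set (conj_list a ys)" using h by (auto simp: conj_list_def)
    show "conj_list a ys \<in> ?Y \<longleftrightarrow> a \<in> H"
    proof
      assume "conj_list a ys \<in> ?Y"
      then have "a \<otimes> h \<otimes> inv a \<in> H" using mem by (auto simp: commuting_tuples_iff)
      then show "a \<in> H" using conj_in_H[OF a h(2,3)] by simp
    next
      assume "a \<in> H"
      then have "set (conj_list a ys) \<subseteq> H" using \<open>set ys \<subseteq> H\<close> by (auto simp: conj_list_def)
      moreover have "conj_list a ys \<in> commuting_tuples G n" using conj_list_closed a YG ys by blast
      moreover have "a \<otimes> h \<otimes> inv a \<noteq> \<one>" using conj_one_cancel[OF a _ ] h by auto
      then have "conj_list a ys \<noteq> replicate n \<one>" using mem by auto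
      ultimately show "conj_list a ys \<in> ?Y" by (simp add: commuting_tuples_carrier[OF H.subset])
    qed
  qed (use YG conj_list_one conj_list_mult in \<open>blast+\<close>)
  then have "card H * card ?Z = card (carrier G) * card ?Y" by simp
  moreover have "replicate n \<one> \<in> commuting_tuples (G\<lparr>carrier := H\<rparr>) n"
    by (auto simp: commuting_tuples_iff)
  then have "card ?Y = card (commuting_tuples (G\<lparr>carrier := H\<rparr>) n) - 1" by simp
  moreover have "card (commuting_tuples G n) = card (commuting_tuples (G\<lparr>carrier := N\<rparr>) n) + card ?Z"
    using card_Un_disjoint[OF _ _ commuting_tuples_disjoint] finite_commuting_tuples[of n]
    unfolding commuting_tuples_eq_Un by simp
  ultimately show ?thesis by (simp add: distrib_left)
qed

lemma beta_frobenius: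
  "card H * beta G n + 1 = beta (G\<lparr>carrier := N\<rparr>) n + card H * beta (G\<lparr>carrier := H\<rparr>) n"
proof -
  have bG: "beta G n * card (carrier G) = card (commuting_tuples G (Suc n))"
    by (rule beta_mult_card)
  have bN: "beta (G\<lparr>carrier := N\<rparr>) n * card N = card (commuting_tuples (G\<lparr>carrier := N\<rparr>) (Suc n))"
    using finite_group.beta_mult_card[OF finite_group_subgroup[OF subgroup_N], of n] by simp
  have bH: "beta (G\<lparr>carrier := H\<rparr>) n * card H = card (commuting_tuples (G\<lparr>carrier := H\<rparr>) (Suc n))"
    using finite_group.beta_mult_card[OF finite_group_subgroup[OF subgroup_H], of n] by simp
  have "replicate (Suc n) \<one> \<in> commuting_tuples (G\<lparr>carrier := H\<rparr>) (Suc n)"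
    by (auto simp: commuting_tuples_iff)
  \<comment> \<open>The trivial tuple makes the subtraction of 1 below a genuine one on natural
    numbers.\<close>
  then have pos: "1 \<le> beta (G\<lparr>carrier := H\<rparr>) n * card H"
    unfolding bH using finite_group.finite_commuting_tuples[OF finite_group_subgroup[OF subgroup_H]]
    by (metis One_nat_def Suc_leI card_gt_0_iff empty_iff)
  have cG: "card (carrier G) > 0" using finite_subgroup(2)[OF subgroup_self] .
  have "card H * (beta G n * card (carrier G)) = card H * (beta (G\<lparr>carrier := N\<rparr>) n * card N) +
      card (carrier G) * (beta (G\<lparr>carrier := H\<rparr>) n * card H - 1)"
    unfolding bG bN bH by (rule card_commuting_tuples)
  \<comment> \<open>Substituting |G| = |N| |H| exposes |G| as a common factor of all terms.\<close>
  then have "card (carrier G) * (card H * beta G n) =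
      card (carrier G) * (beta (G\<lparr>carrier := N\<rparr>) n + (beta (G\<lparr>carrier := H\<rparr>) n * card H - 1))"
    by (simp add: card_N_H[symmetric] algebra_simps)
  then have "card H * beta G n = beta (G\<lparr>carrier := N\<rparr>) n + (beta (G\<lparr>carrier := H\<rparr>) n * card H - 1)"
    using cG by (metis mult_left_cancel less_irrefl)
  then show ?thesis using pos by (simp add: mult.commute)
qed

lemma B_series_frobenius:
  "B_series G = fps_const (1 / of_nat (card H)) * (B_series (G\<lparr>carrier := N\<rparr>) - Abs_fps (\<lambda>_. 1)) +
     B_series (G\<lparr>carrier := H\<rparr>)"
proof (rule fps_ext)
  fix n
  have "(of_nat (card H * beta G n + 1) :: rat) =
      of_nat (beta (G\<lparr>carrier := N\<rparr>) n + card H * beta (G\<lparr>carrier := H\<rparr>) n)"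
    by (simp only: beta_frobenius)
  moreover have h: "(of_nat (card H) :: rat) \<noteq> 0" using finite_subgroup(2)[OF subgroup_H] by simp
  ultimately have "of_nat (beta G n) = (of_nat (beta (G\<lparr>carrier := N\<rparr>) n) +
      of_nat (card H) * of_nat (beta (G\<lparr>carrier := H\<rparr>) n) - 1) / (of_nat (card H) :: rat)"
    by (simp add: eq_divide_eq algebra_simps)
  then show "fps_nth (B_series G) n = fps_nth (fps_const (1 / of_nat (card H)) *
      (B_series (G\<lparr>carrier := N\<rparr>) - Abs_fps (\<lambda>_. 1)) + B_series (G\<lparr>carrier := H\<rparr>)) n"
    using h by (simp add: B_series_def add_divide_distrib diff_divide_distrib)
qed

end

lemma one_minus_X_mult_geometric: "(1 - fps_X) * Abs_fps (\<lambda>_. 1 :: rat) = 1"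
  by (rule fps_ext) (simp add: left_diff_distrib)

theorem theorem9p3:
  fixes G :: "('a, 'b) monoid_scheme" and H N :: "'a set"
  assumes "group G" and "finite (carrier G)"
    and "frobenius_complement G H"
    and "N = frobenius_kernel G H"
  shows "(1 - fps_X) * B_series G =
     1 + fps_const (1 / of_nat (card H)) * ((1 - fps_X) * B_series (G\<lparr>carrier := N\<rparr>) - 1)
       + ((1 - fps_X) * B_series (G\<lparr>carrier := H\<rparr>) - 1)"
proof -
  interpret frobenius_group G H N
    using assms by (simp add: frobenius_group_def finite_group_def finite_group_axioms_def
        frobenius_group_axioms_def)
  \<comment> \<open>The series with all coefficients 1 carries the \<open>+ 1\<close> of
    \<open>beta_frobenius\<close> and becomes 1 after multiplication by \<open>1 - fps_X\<close>.
    The outer 1 of the claim cancels against the -1 of the \<open>H\<close> term.\<close>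
  have "(1 - fps_X) * B_series G =
      fps_const (1 / of_nat (card H)) * ((1 - fps_X) * B_series (G\<lparr>carrier := N\<rparr>)
        - (1 - fps_X) * Abs_fps (\<lambda>_. 1)) + (1 - fps_X) * B_series (G\<lparr>carrier := H\<rparr>)"
    unfolding B_series_frobenius by (simp only: algebra_simps)
  then show ?thesis by (simp only: one_minus_X_mult_geometric) simp
qed

end
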